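(* Let $0<a\le 2$ and let $d>d_a$, where $d_a=3$ if $a=1$ and $d_a=2$ if $a\neq 1$. Then there is no constant $C<\infty$ such that \[ \|e^{itD^a}f\|_{L^2_tL^\infty_x(\mathbb{R}\times\mathbb{R}^d)}\le C\,\|f\|_{H^{\frac{d-a}{2}}(\mathbb{R}^d)} \] holds for all Schwartz functions $f$ on $\mathbb{R}^d$.
   Context: $D=\sqrt{-\Delta}$ on $\mathbb{R}^d$, and $e^{itD^a}=\mathcal{F}^{-1}e^{it|\xi|^a}\mathcal{F}$ is the Fourier multiplier with symbol $e^{it|\xi|^a}$ (Fourier transform $\hat f(\xi)=\int e^{-ix\cdot\xi}f(x)\,dx$). $H^s$ denotes the inhomogeneous $L^2$-Sobolev space with norm $\|(1+|\xi|^2)^{s/2}\hat f\|_{L^2}$. $\|u\|_{L^2_tL^\infty_x}=\big\|\|u(t,\cdot)\|_{L^\infty(\mathbb{R}^d)}\big\|_{L^2_t(\mathbb{R})}$. *)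

theory Defs
  imports "HOL-Analysis.Analysis" "HOL-Probability.Essential_Supremum"
begin

definition dpart :: "'n::finite \<Rightarrow> (real^'n \<Rightarrow> complex) \<Rightarrow> real^'n \<Rightarrow> complex" where
  "dpart i g x = vector_derivative (\<lambda>s. g (x + s *\<^sub>R axis i 1)) (at 0)"

fun dparts :: "'n::finite list \<Rightarrow> (real^'n \<Rightarrow> complex) \<Rightarrow> real^'n \<Rightarrow> complex" where
  "dparts [] g = g"
| "dparts (i # js) g = dpart i (dparts js g)"

definition schwartz :: "(real^'n::finite \<Rightarrow> complex) \<Rightarrow> bool" where
  "schwartz f \<longleftrightarrow>
     (\<forall>js. (\<forall>x. dparts js f differentiable (at x)) \<and>
           (\<forall>k::nat. \<exists>B. \<forall>x. (1 + norm x) ^ k * cmod (dparts js f x) \<le> B))"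

definition fourier :: "(real^'n::finite \<Rightarrow> complex) \<Rightarrow> real^'n \<Rightarrow> complex" where
  "fourier f \<xi> = (\<integral>x. cis (- (x \<bullet> \<xi>)) * f x \<partial>lborel)"

definition frac_evol :: "real \<Rightarrow> (real^'n::finite \<Rightarrow> complex) \<Rightarrow> real \<Rightarrow> real^'n \<Rightarrow> complex" where
  "frac_evol a f t x =
     (1 / (2 * pi) ^ CARD('n)) *
     (\<integral>\<xi>. cis (x \<bullet> \<xi>) * cis (t * norm \<xi> powr a) * fourier f \<xi> \<partial>lborel)"

definition sobolev_norm :: "real \<Rightarrow> (real^'n::finite \<Rightarrow> complex) \<Rightarrow> real" where
  "sobolev_norm s f = sqrt (\<integral>\<xi>. (1 + (norm \<xi>)\<^sup>2) powr s * (cmod (fourier f \<xi>))\<^sup>2 \<partial>lborel)"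

definition L2Linf_sq :: "(real \<Rightarrow> real^'n::finite \<Rightarrow> complex) \<Rightarrow> ennreal" where
  "L2Linf_sq u = (\<integral>\<^sup>+ t. (e2ennreal (esssup lborel (\<lambda>x. ereal (cmod (u t x))))) ^ 2 \<partial>lborel)"

end

theory Submission
  imports Defs "HOL-Probability.Characteristic_Functions" "HOL-Real_Asymp.Real_Asymp"
begin

text \<open>The exponent is critical. Where |\<xi>| is about 2 powr (J / a), the weight times the
  volume of the dyadic shell is about 2 ^ J, so a mean square of order 2 powr (-J) for G makes all
  scales count equally. This is the size of an average of 2 ^ J unit vectors in unrelated
  directions: on an interval of length 2 powr (-J) the phase t |\<xi>| powr a turns by about one
  radian at most, so each interval contributes a definite vector, and the path must scramble the
  directions. The obstacle is that one path has to do this at all N scales at once. Hence the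
  geometrically decreasing steps: seen from scale J, the steps up to J blur the phase completely,
  and the later ones hardly move it. Averaging over the steps also decouples them from the linear
  phase, because the mean factorises over the levels. The data must be Schwartz functions with
  prescribed Fourier transform. Modulated Gaussians supply them explicitly, and a density argument
  takes the place of Fourier inversion.\<close>

text \<open>
  Evaluating the solution along a path \<open>x(t)\<close> bounds its
  \<open>L\<^sup>2\<^sub>tL\<^sup>\<infinity>\<^sub>x\<close> norm from below, so by duality the
  estimate would bound
  \<open>\<integral> |G(\<xi>)|\<^sup>2 (1 + |\<xi>|\<^sup>2) powr (- (d - a) / 2) d\<xi>\<close>
  uniformly over all paths, where
  \<open>G(\<xi>) = \<integral>\<^sub>0\<^sup>1 cis (t |\<xi>| powr a + x(t) \<bullet> \<xi>) dt\<close>.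
  Take \<open>x(t) = y(t) e\<^sub>i\<close> with \<open>y(t) = \<Sum>\<^sub>j \<epsilon>\<^sub>j(t) s\<^sub>j\<close>,
  where \<open>\<epsilon>\<^sub>j(t)\<close> are the binary digits of \<open>t\<close> and the \<open>s\<^sub>j\<close> are
  independent Gaussians of size \<open>2 powr (- j / a)\<close>. Then \<open>|G|\<^sup>2\<close> is a product of squared
  cosines, and there is only square-root cancellation: its mean is at least a constant times
  \<open>2 powr (- J)\<close> for \<open>|\<xi>|\<close> comparable to \<open>2 powr (J / a)\<close>. Each of the \<open>N\<close> scales thus
  contributes at least a fixed amount to the integral, which is therefore unbounded.
\<close>

subsection \<open>Gaussians and their Fourier transforms\<close>

text \<open>The substitution x -> \<open>c\<close> * x with c^2 = 2 b reduces the integral to the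
  characteristic function of the standard normal distribution.\<close>

lemma integral_gauss_cis_1:
  fixes b y :: real
  assumes b: "b > 0"
  shows "integrable lborel (\<lambda>x::real. complex_of_real (exp (- b * x\<^sup>2)) * cis (y * x))" (is ?int)
    and "(\<integral>x. complex_of_real (exp (- b * x\<^sup>2)) * cis (y * x) \<partial>lborel)
         = complex_of_real (sqrt (pi / b) * exp (- (y\<^sup>2) / (4 * b)))"
proof -
  define c where "c = sqrt (2 * b)"
  have c: "c > 0" "c\<^sup>2 = 2 * b" using b by (auto simp: c_def)
  define f where "f = (\<lambda>x::real. complex_of_real (std_normal_density x) * cis (y / c * x))"
  have fint: "integrable lborel f"
    unfolding f_def
    by (rule Bochner_Integration.integrable_bound[OF integrable_std_normal_moment[of 0]]) 
       (auto simp: norm_mult cis_conv_exp)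
  have "complex_of_real (exp (- (y/c)\<^sup>2 / 2)) = char std_normal_distribution (y/c)"
    by (simp add: char_std_normal_distribution)
  also have "\<dots> = (\<integral>x. f x \<partial>lborel)"
    unfolding char_def f_def
    by (subst integral_density) (auto simp: cis_conv_exp scaleR_conv_of_real)
  finally have fI: "(\<integral>x. f x \<partial>lborel) = complex_of_real (exp (- (y/c)\<^sup>2 / 2))" ..
  have fc: "f (0 + c * x) = complex_of_real (exp (- b * x\<^sup>2)) * cis (y * x) / complex_of_real (sqrt (2*pi))" for x
    using c by (simp add: f_def normal_density_def power_mult_distrib)
  have 1: "integrable lborel (\<lambda>x. f (0 + c * x))"
    using lborel_integrable_real_affine[OF fint, of c 0] c by simp
  have "integrable lborel (\<lambda>x. complex_of_real (sqrt (2*pi)) * f (0 + c * x))"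
    using 1 by simp
  then show ?int unfolding fc by simp
  have "(\<integral>x. f x \<partial>lborel) = c *\<^sub>R (\<integral>x. f (0 + c * x) \<partial>lborel)"
    using lborel_integral_real_affine[of c f 0] c by simp
  then have "(\<integral>x. complex_of_real (exp (- b * x\<^sup>2)) * cis (y * x) \<partial>lborel)
     = complex_of_real (sqrt (2*pi) / c * exp (- (y/c)\<^sup>2 / 2))"
    using c fI unfolding fc by (simp add: field_simps scaleR_conv_of_real)
  moreover have "sqrt (2*pi) / c = sqrt (pi / b)" "- (y/c)\<^sup>2 / 2 = - (y\<^sup>2) / (4 * b)"
    using b c by (auto simp: c_def real_sqrt_divide real_sqrt_mult power_divide)
  ultimately show "(\<integral>x. complex_of_real (exp (- b * x\<^sup>2)) * cis (y * x) \<partial>lborel)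
         = complex_of_real (sqrt (pi / b) * exp (- (y\<^sup>2) / (4 * b)))"
    by (simp only:)
qed

text \<open>\<open>lborel_eq\<close> presents Lebesgue measure as an image of the product of
  one-dimensional ones, so a tensor product integrates factor by factor.\<close>

lemma lborel_prod_integral:
  fixes f :: "'a::euclidean_space \<Rightarrow> real \<Rightarrow> complex"
  assumes int: "\<And>b. b \<in> Basis \<Longrightarrow> integrable lborel (f b)"
  shows "integrable lborel (\<lambda>x. \<Prod>b\<in>Basis. f b (x \<bullet> b))"
    and "(\<integral>x. (\<Prod>b\<in>Basis. f b (x \<bullet> b)) \<partial>lborel) = (\<Prod>b\<in>Basis. (\<integral>x. f b x \<partial>lborel))"
proof -
  interpret product_sigma_finite "\<lambda>_::'a. lborel :: real measure" by standard
  have m[measurable]: "f b \<in> borel_measurable borel" if "b \<in> Basis" for b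
    using borel_measurable_integrable[OF int[OF that]] by simp
  have inner: "(\<Sum>b\<in>Basis. g b *\<^sub>R b) \<bullet> c = g c" if "c \<in> Basis" for g :: "'a \<Rightarrow> real" and c
    using that by (simp add: inner_sum_left inner_Basis if_distrib cong: if_cong)
  have eq: "(\<Prod>b\<in>Basis. f b ((\<Sum>b\<in>Basis. g b *\<^sub>R b) \<bullet> b)) = (\<Prod>b\<in>Basis. f b (g b))" for g
    by (intro prod.cong refl) (simp add: inner)
  have m2: "(\<lambda>x. \<Prod>b\<in>Basis. f b (x \<bullet> b)) \<in> borel_measurable borel"
    by measurable
  have m3: "(\<lambda>g. \<Sum>b\<in>Basis. g b *\<^sub>R b) \<in> measurable (\<Pi>\<^sub>M b\<in>(Basis::'a set). lborel) borel"
    by measurable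
  show "integrable lborel (\<lambda>x. \<Prod>b\<in>Basis. f b (x \<bullet> b))"
    by (subst lborel_eq, subst integrable_distr_eq[OF m3 m2]) (simp add: eq product_integrable_prod int)
  show "(\<integral>x. (\<Prod>b\<in>Basis. f b (x \<bullet> b)) \<partial>lborel) = (\<Prod>b\<in>Basis. (\<integral>x. f b x \<partial>lborel))"
    by (subst lborel_eq, subst integral_distr[OF m3 m2]) (simp add: eq product_integral_prod int)
qed

lemma cis_sum: "(\<Prod>i\<in>A. cis (f i)) = cis (\<Sum>i\<in>A. f i)"
  by (induction A rule: infinite_finite_induct) (simp_all add: cis_mult)

lemma norm_sq_Basis: "(norm (x::'a::euclidean_space))\<^sup>2 = (\<Sum>b\<in>Basis. (x \<bullet> b)\<^sup>2)"
  unfolding power2_norm_eq_inner by (subst euclidean_inner) (simp add: power2_eq_square)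

lemma gauss_cis_prod:
  "complex_of_real (exp (- b * (norm (x::'a::euclidean_space))\<^sup>2)) * cis (y \<bullet> x)
   = (\<Prod>c\<in>Basis. complex_of_real (exp (- b * (x \<bullet> c)\<^sup>2)) * cis ((y \<bullet> c) * (x \<bullet> c)))"
  by (simp add: prod.distrib cis_sum norm_sq_Basis exp_sum[symmetric] sum_distrib_left sum_negf
       flip: of_real_prod) (simp add: euclidean_inner[of y x])

lemma gauss_cis_integral:
  fixes y :: "'a::euclidean_space"
  assumes b: "b > 0"
  shows "integrable lborel (\<lambda>x. complex_of_real (exp (- b * (norm x)\<^sup>2)) * cis (y \<bullet> x))"
    and "(\<integral>x. complex_of_real (exp (- b * (norm x)\<^sup>2)) * cis (y \<bullet> x) \<partial>lborel)
         = complex_of_real (sqrt (pi / b) ^ DIM('a) * exp (- (norm y)\<^sup>2 / (4 * b)))"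
proof -
  note int = integral_gauss_cis_1[OF b]
  show "integrable lborel (\<lambda>x. complex_of_real (exp (- b * (norm x)\<^sup>2)) * cis (y \<bullet> x))"
    unfolding gauss_cis_prod
    by (rule lborel_prod_integral(1)[where f="\<lambda>c t. complex_of_real (exp (- b * t\<^sup>2)) * cis ((y \<bullet> c) * t)"]) (rule int)
  have "(\<integral>x. complex_of_real (exp (- b * (norm x)\<^sup>2)) * cis (y \<bullet> x) \<partial>lborel)
     = (\<Prod>c\<in>Basis. complex_of_real (sqrt (pi / b) * exp (- ((y \<bullet> c)\<^sup>2) / (4 * b))))"
    unfolding gauss_cis_prod
    by (subst lborel_prod_integral(2)[where f="\<lambda>c t. complex_of_real (exp (- b * t\<^sup>2)) * cis ((y \<bullet> c) * t)"])
       (simp_all only: int)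
  also have "\<dots> = complex_of_real (\<Prod>c\<in>(Basis::'a set). sqrt (pi / b) * exp (- ((y \<bullet> c)\<^sup>2) / (4 * b)))"
    by simp
  also have "(\<Prod>c\<in>(Basis::'a set). sqrt (pi / b) * exp (- ((y \<bullet> c)\<^sup>2) / (4 * b)))
      = sqrt (pi / b) ^ DIM('a) * exp (- (norm y)\<^sup>2 / (4 * b))"
    by (simp add: prod.distrib exp_sum[symmetric] norm_sq_Basis sum_divide_distrib sum_negf)
  finally show "(\<integral>x. complex_of_real (exp (- b * (norm x)\<^sup>2)) * cis (y \<bullet> x) \<partial>lborel)
         = complex_of_real (sqrt (pi / b) ^ DIM('a) * exp (- (norm y)\<^sup>2 / (4 * b)))" .
qed

lemma fourier_gauss_cis:
  fixes y :: "real^'n"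
  assumes b: "b > 0"
  shows "fourier (\<lambda>x. complex_of_real (exp (- b * (norm x)\<^sup>2)) * cis (y \<bullet> x)) \<xi>
         = complex_of_real (sqrt (pi / b) ^ CARD('n) * exp (- (norm (\<xi> - y))\<^sup>2 / (4 * b)))"
proof -
  have "cis (- (x \<bullet> \<xi>)) * (complex_of_real (exp (- b * (norm x)\<^sup>2)) * cis (y \<bullet> x))
     = complex_of_real (exp (- b * (norm x)\<^sup>2)) * cis ((y - \<xi>) \<bullet> x)" for x
    by (simp add: inner_diff_left inner_commute cis_mult algebra_simps)
  then show ?thesis
    unfolding fourier_def by (simp only: gauss_cis_integral(2)[OF b]) (simp add: norm_minus_commute)
qed

section \<open>Schwartz property of modulated Gaussians\<close>

text \<open>Polynomial multiples of modulated Gaussians. Differentiating a Gaussian brings down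
  coordinate factors, so \<open>coord\<close> is what closes the class under \<open>dpart\<close>
  and thus under all the derivatives in \<open>schwartz\<close>.\<close>

inductive hermite_type :: "(real^'n \<Rightarrow> complex) \<Rightarrow> bool" where
  base: "b > 0 \<Longrightarrow> hermite_type (\<lambda>x. c * (complex_of_real (exp (- b * (norm x)\<^sup>2)) * cis (y \<bullet> x)))"
| add: "hermite_type f \<Longrightarrow> hermite_type g \<Longrightarrow> hermite_type (\<lambda>x. f x + g x)"
| coord: "hermite_type f \<Longrightarrow> hermite_type (\<lambda>x. complex_of_real (x $ i) * f x)"

text \<open>A full derivative \<open>D\<close> meets two needs: \<open>schwartz\<close> asks for
  differentiability, and \<open>dpart\<close> is the value of \<open>D\<close> on an axis
  vector.\<close>

lemma hermite_type_has_derivative: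
  fixes f :: "real^'n \<Rightarrow> complex"
  assumes "hermite_type f"
  shows "\<exists>D. (\<forall>x. (f has_derivative D x) (at x)) \<and> (\<forall>i. hermite_type (\<lambda>x. D x (axis i 1)))"
  using assms
proof induction
  case (base b c y)
  define E where "E = (\<lambda>x::real^'n. complex_of_real (exp (- b * (norm x)\<^sup>2)) * cis (y \<bullet> x))"
  define q where "q = (\<lambda>x::real^'n. complex_of_real (- b * (x \<bullet> x)) + \<i> * complex_of_real (y \<bullet> x))"
  have Eq: "E x = exp (q x)" for x
    by (simp only: E_def q_def cis_conv_exp exp_add exp_of_real[symmetric] power2_norm_eq_inner)
  have dq: "(q has_derivative (\<lambda>h. complex_of_real (- 2 * b * (x \<bullet> h)) + \<i> * complex_of_real (y \<bullet> h))) (at x)" for x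
    unfolding q_def by (auto intro!: derivative_eq_intros simp: inner_commute algebra_simps)
  have dE: "((\<lambda>x. c * E x) has_derivative (\<lambda>h. c * (E x * (complex_of_real (- 2 * b * (x \<bullet> h)) + \<i> * complex_of_real (y \<bullet> h))))) (at x)" for x
    unfolding Eq
    by (intro has_derivative_mult_right has_derivative_compose[OF dq]
          DERIV_exp[unfolded has_field_derivative_def])
  moreover have "hermite_type (\<lambda>x. c * (E x * (complex_of_real (- 2 * b * (x \<bullet> axis i 1)) + \<i> * complex_of_real (y \<bullet> axis i 1))))" for i
  proof -
    have "hermite_type (\<lambda>x. complex_of_real (x $ i) * ((c * complex_of_real (- 2 * b)) * E x) + (c * \<i> * complex_of_real (y $ i)) * E x)"
      unfolding E_def by (intro hermite_type.intros base)
    then show ?thesis by (simp add: inner_axis algebra_simps)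
  qed
  ultimately have "\<exists>D. (\<forall>x. ((\<lambda>x. c * E x) has_derivative D x) (at x)) \<and> (\<forall>i. hermite_type (\<lambda>x. D x (axis i 1)))"
    by (intro exI[of _ "\<lambda>x h. c * (E x * (complex_of_real (- 2 * b * (x \<bullet> h)) + \<i> * complex_of_real (y \<bullet> h)))"] conjI allI)
  then show ?case unfolding E_def .
next
  case (add f g)
  then obtain D1 D2 where "\<And>x. (f has_derivative D1 x) (at x)" "\<And>x. (g has_derivative D2 x) (at x)"
    "\<And>i. hermite_type (\<lambda>x. D1 x (axis i 1))" "\<And>i. hermite_type (\<lambda>x. D2 x (axis i 1))" by blast
  then show ?case
    by (intro exI[of _ "\<lambda>x h. D1 x h + D2 x h"]) (auto intro: has_derivative_add hermite_type.add)
next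
  case (coord f j)
  then obtain D where D: "\<And>x. (f has_derivative D x) (at x)" "\<And>i. hermite_type (\<lambda>x. D x (axis i 1))" by blast
  have d: "((\<lambda>x. complex_of_real (x $ j) * f x) has_derivative (\<lambda>h. complex_of_real (x $ j) * D x h + complex_of_real (h $ j) * f x)) (at x)" for x
    by (rule has_derivative_mult[OF _ D(1)])
       (intro bounded_linear.has_derivative[OF bounded_linear_of_real] bounded_linear_imp_has_derivative bounded_linear_vec_nth)
  \<comment> \<open>Constants are absorbed in the base case. The constant in question is
    \<open>axis i 1 $ j\<close>, the derivative of the coordinate factor.\<close>
  have z: "hermite_type (\<lambda>x. c * f x)" if "hermite_type f" for c :: complex and f :: "real^'n \<Rightarrow> complex"
    using that
  proof induction
    case (base b c' y)
    show ?case using hermite_type.base[OF base, of "c * c'" y] by (simp add: mult.assoc)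
  next
    case (add f g) then show ?case using hermite_type.add by (simp add: distrib_left)
  next
    case (coord f i) show ?case using hermite_type.coord[OF coord.IH, of i] by (simp add: mult.left_commute)
  qed
  have "hermite_type (\<lambda>x. complex_of_real (x $ j) * D x (axis i 1) + complex_of_real (axis i 1 $ j) * f x)" for i
    using D coord by (intro hermite_type.add hermite_type.coord z)
  with d show ?case 
    by (intro exI[of _ "\<lambda>x h. complex_of_real (x $ j) * D x h + complex_of_real (h $ j) * f x"] conjI allI)
qed

lemma hermite_type_dpart:
  fixes f :: "real^'n \<Rightarrow> complex"
  assumes "hermite_type f"
  shows "hermite_type (dpart i f)"
proof -
  from hermite_type_has_derivative[OF assms] obtain D
    where D: "\<And>x. (f has_derivative D x) (at x)" "hermite_type (\<lambda>x. D x (axis i 1))" by blast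
  have "dpart i f x = D x (axis i 1)" for x
  proof -
    have 1: "((\<lambda>s. x + s *\<^sub>R axis i 1) has_derivative (\<lambda>s. s *\<^sub>R axis i 1)) (at (0::real))"
      by (auto intro!: derivative_eq_intros)
    have "((\<lambda>s. f (x + s *\<^sub>R axis i 1)) has_derivative (\<lambda>s. D x (s *\<^sub>R axis i 1))) (at (0::real))"
      using has_derivative_compose[OF 1, of f "D x"] D(1)[of x] by simp
    then have "((\<lambda>s. f (x + s *\<^sub>R axis i 1)) has_vector_derivative D x (axis i 1)) (at (0::real))"
      unfolding has_vector_derivative_def
      by (simp add: linear_scale[OF has_derivative_linear[OF D(1)]])
    then show ?thesis unfolding dpart_def by (rule vector_derivative_at)
  qed
  then have "dpart i f = (\<lambda>x. D x (axis i 1))" by auto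
  with D(2) show ?thesis by simp
qed

text \<open>Since 1 + r \<le> exp r, the product is at most exp (k r - b r^2), and completing the
  square bounds the exponent by k^2 / (4 b).\<close>

lemma power_times_gauss_bounded:
  assumes b: "b > (0::real)"
  shows "\<exists>B. \<forall>r\<ge>0. (1 + r) ^ k * exp (- b * r\<^sup>2) \<le> B"
proof -
  have "(1 + r) ^ k * exp (- b * r\<^sup>2) \<le> exp (real k ^ 2 / (4 * b))" if r: "r \<ge> 0" for r
  proof -
    have "(1 + r) ^ k \<le> exp r ^ k"
      using r by (intro power_mono) auto
    also have "\<dots> = exp (real k * r)" by (simp add: exp_of_nat_mult)
    finally have "(1 + r) ^ k * exp (- b * r\<^sup>2) \<le> exp (real k * r) * exp (- b * r\<^sup>2)"
      by (intro mult_right_mono) auto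
    also have "\<dots> = exp (real k * r - b * r\<^sup>2)" by (simp add: exp_add[symmetric])
    also have "real k * r - b * r\<^sup>2 \<le> real k ^ 2 / (4 * b)"
    proof -
      have "0 \<le> (real k - 2 * b * r)\<^sup>2" by simp
      then have "4 * b * (real k * r - b * r\<^sup>2) \<le> real k ^ 2"
        by (simp add: power2_eq_square algebra_simps)
      then show ?thesis using b by (simp add: field_simps)
    qed
    finally show ?thesis by simp
  qed
  then show ?thesis by blast
qed

text \<open>The exponent \<open>k\<close> is generalised in the induction because a coordinate
  factor costs one more power of 1 + norm x.\<close>

lemma hermite_type_decay:
  fixes f :: "real^'n \<Rightarrow> complex"
  assumes "hermite_type f"
  shows "\<exists>B. \<forall>x. (1 + norm x) ^ k * cmod (f x) \<le> B"
  using assms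
proof (induction arbitrary: k)
  case (base b c y)
  obtain B where B: "\<And>r. r \<ge> 0 \<Longrightarrow> (1 + r) ^ k * exp (- b * r\<^sup>2) \<le> B"
    using power_times_gauss_bounded[OF base] by blast
  show ?case
  proof (intro exI allI)
    fix x :: "real^'n"
    show "(1 + norm x) ^ k * cmod (c * (complex_of_real (exp (- b * (norm x)\<^sup>2)) * cis (y \<bullet> x))) \<le> cmod c * B"
      using mult_left_mono[OF B[of "norm x"], of "cmod c"] by (simp add: norm_mult mult_ac)
  qed
next
  case (add f g)
  from add.IH(1)[of k] add.IH(2)[of k] obtain B1 B2 where
    B: "\<And>x. (1 + norm x) ^ k * cmod (f x) \<le> B1" "\<And>x. (1 + norm x) ^ k * cmod (g x) \<le> B2" by blast
  show ?case
  proof (intro exI allI)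
    fix x
    have "(1 + norm x) ^ k * cmod (f x + g x) \<le> (1 + norm x) ^ k * (cmod (f x) + cmod (g x))"
      by (intro mult_left_mono norm_triangle_ineq) auto
    also have "\<dots> \<le> B1 + B2" using B[of x] by (simp add: distrib_left)
    finally show "(1 + norm x) ^ k * cmod (f x + g x) \<le> B1 + B2" .
  qed
next
  case (coord f i)
  from coord.IH[of "Suc k"] obtain B where B: "\<And>x. (1 + norm x) ^ Suc k * cmod (f x) \<le> B" by blast
  show ?case
  proof (intro exI allI)
    fix x
    have "\<bar>x $ i\<bar> \<le> 1 + norm x" using component_le_norm_cart[of x i] by simp
    then have "(1 + norm x) ^ k * (\<bar>x $ i\<bar> * cmod (f x)) \<le> (1 + norm x) ^ k * ((1 + norm x) * cmod (f x))"
      by (intro mult_left_mono mult_right_mono) auto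
    also have "\<dots> \<le> B" using B[of x] by (simp add: mult_ac)
    finally show "(1 + norm x) ^ k * cmod (complex_of_real (x $ i) * f x) \<le> B" by (simp add: norm_mult)
  qed
qed

lemma schwartz_hermite_type:
  fixes f :: "real^'n \<Rightarrow> complex"
  assumes "hermite_type f"
  shows "schwartz f"
proof -
  have h: "hermite_type (dparts js f)" for js
    by (induction js) (simp_all add: assms hermite_type_dpart)
  show ?thesis unfolding schwartz_def
  proof (intro allI conjI)
    fix js x k
    show "dparts js f differentiable at x"
      using hermite_type_has_derivative[OF h[of js]] unfolding differentiable_def by blast
    show "\<exists>B. \<forall>x. (1 + norm x) ^ k * cmod (dparts js f x) \<le> B"
      by (rule hermite_type_decay[OF h])
  qed
qed

text \<open>
  Complex multiples of real exponentials of quadratic forms are closed under multiplication and,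
  for \<open>k\<^sub>0 > 0\<close>, are Fourier transforms of modulated Gaussians. They serve as
  the dense class of admissible \<open>fourier f\<close>.
\<close>

inductive exp_quadratic :: "real \<Rightarrow> (real^'n \<Rightarrow> complex) \<Rightarrow> bool" for k\<^sub>0 where
  base: "k \<ge> k\<^sub>0 \<Longrightarrow> exp_quadratic k\<^sub>0 (\<lambda>x. c * complex_of_real (exp (- k * (norm x)\<^sup>2 + y \<bullet> x)))"
| add: "exp_quadratic k\<^sub>0 f \<Longrightarrow> exp_quadratic k\<^sub>0 g \<Longrightarrow> exp_quadratic k\<^sub>0 (\<lambda>x. f x + g x)"

text \<open>Exponents add, and so do the lower bounds on the decay rates. With both rates 0 this
  gives closure under products; with one rate 1 it lets a Gaussian factor restore decay.\<close>

lemma exp_quadratic_mult: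
  fixes f g :: "real^'n \<Rightarrow> complex"
  assumes "exp_quadratic k f" "exp_quadratic l g"
  shows "exp_quadratic (k + l) (\<lambda>x. f x * g x)"
  using assms(1)
proof induction
  case (base k' c y)
  note k' = this
  show ?case using assms(2)
  proof induction
    case (base l' c' y')
    show ?case using exp_quadratic.base[of "k + l" "k' + l'" "c * c'" "y + y'"] k' base
      by (simp add: algebra_simps inner_add_left exp_add exp_diff exp_minus)
  next
    case (add f g) then show ?case using exp_quadratic.add by (simp add: distrib_left)
  qed
next
  case (add f f') then show ?case using exp_quadratic.add by (simp add: distrib_right)
qed

lemma exp_quadratic_is_fourier:
  fixes g :: "real^'n \<Rightarrow> complex"
  assumes "exp_quadratic k g" "k > 0"
  shows "\<exists>f. schwartz f \<and> fourier f = g"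
proof -
  \<comment> \<open>Integrability joins the induction claim because additivity of
    \<open>fourier\<close> relies on it.\<close>
  have "\<exists>f. hermite_type f \<and> integrable lborel f \<and> fourier f = g"
    using assms(1)
  proof induction
    case (base l c y)
    then have l: "l > 0" using assms(2) by simp
    \<comment> \<open>Completing the square: the exponent is that of a Gaussian of rate l = 1 / (4
      b) centred at \<open>z\<close>, up to the constant (norm y)^2 / (4 l), which \<open>c'\<close>
      compensates together with the normalisation of \<open>fourier_gauss_cis\<close>.\<close>
    define b where "b = 1 / (4 * l)"
    define z where "z = y /\<^sub>R (2 * l)"
    have b: "b > 0" using l by (simp add: b_def)
    define c' where "c' = c * complex_of_real (exp ((norm y)\<^sup>2 / (4 * l)) / sqrt (pi / b) ^ CARD('n))"
    define f where "f = (\<lambda>x::real^'n. c' * (complex_of_real (exp (- b * (norm x)\<^sup>2)) * cis (z \<bullet> x)))"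
    have e: "- (norm (\<xi> - z))\<^sup>2 / (4 * b) + (norm y)\<^sup>2 / (4 * l) = - l * (norm \<xi>)\<^sup>2 + y \<bullet> \<xi>" for \<xi>
      unfolding power2_norm_eq_inner b_def z_def using l
      by (simp add: inner_diff_left inner_diff_right inner_commute field_simps power2_eq_square)
    have "fourier f \<xi> = c * complex_of_real (exp (- l * (norm \<xi>)\<^sup>2 + y \<bullet> \<xi>))" for \<xi>
    proof -
      have "fourier f \<xi> = c' * fourier (\<lambda>x. complex_of_real (exp (- b * (norm x)\<^sup>2)) * cis (z \<bullet> x)) \<xi>"
        unfolding fourier_def f_def by (subst integral_mult_right_zero[symmetric]) (simp add: mult_ac)
      also have "\<dots> = c * complex_of_real (exp (- (norm (\<xi> - z))\<^sup>2 / (4 * b)) * exp ((norm y)\<^sup>2 / (4 * l)))"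
        unfolding fourier_gauss_cis[OF b] c'_def using b by simp
      finally show ?thesis by (simp only: exp_add[symmetric] e)
    qed
    moreover have "hermite_type f" unfolding f_def using b by (rule hermite_type.base)
    moreover have "integrable lborel f" unfolding f_def by (intro integrable_mult_right gauss_cis_integral(1)[OF b])
    ultimately show ?case by blast
  next
    case (add g1 g2)
    then obtain f1 f2 where f: "hermite_type f1" "hermite_type f2" "integrable lborel f1" "integrable lborel f2"
      "fourier f1 = g1" "fourier f2 = g2" by blast
    have i: "integrable lborel (\<lambda>x. cis (- (x \<bullet> \<xi>)) * f x)" if "integrable lborel f" for f and \<xi> :: "real^'n"
    proof (rule Bochner_Integration.integrable_bound[OF that])
      have [measurable]: "f \<in> borel_measurable borel" using that by auto
      show "(\<lambda>x. cis (- (x \<bullet> \<xi>)) * f x) \<in> borel_measurable lborel"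
        unfolding cis_conv_exp by measurable
    qed (simp add: norm_mult)
    have "fourier (\<lambda>x. f1 x + f2 x) = (\<lambda>x. g1 x + g2 x)"
      using f(5,6) unfolding fourier_def fun_eq_iff by (simp add: distrib_left i f(3,4))
    with f show ?case by (intro exI[of _ "\<lambda>x. f1 x + f2 x"]) (auto intro: hermite_type.add)
  qed
  then show ?thesis using schwartz_hermite_type by blast
qed

subsection \<open>Density of exponentials of quadratic forms\<close>

text \<open>Each coordinate of the argument is a single exponential of rate 1, and a linear
  functional is a combination of coordinates. Rate 0 is the only bound that admits constant
  polynomials; decay is restored in \<open>exp_quadratic_dense\<close>.\<close>

lemma exp_quadratic_real_polynomial:
  fixes P :: "((real^'n) \<times> real) \<Rightarrow> real"
  assumes "real_polynomial_function P"
  shows "exp_quadratic 0 (\<lambda>\<xi>::real^'n. complex_of_real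
           (P (\<chi> i. exp (- (norm \<xi>)\<^sup>2 + \<xi> $ i), exp (- (norm \<xi>)\<^sup>2))))"
  using assms
proof induction
  case (linear f)
  interpret bounded_linear f by fact
  have c: "exp_quadratic 0 (\<lambda>\<xi>::real^'n. complex_of_real (\<Sum>i\<in>A. exp (- (norm \<xi>)\<^sup>2 + \<xi> $ i) * f (axis i 1, 0)))" 
    if "finite A" for A :: "'n set"
    using that
  proof induction
    case empty
    show ?case using exp_quadratic.base[of 0 0 0 0] by simp
  next
    case (insert i A)
    have "exp_quadratic 0 (\<lambda>\<xi>::real^'n. complex_of_real (f (axis i 1, 0)) * complex_of_real (exp (- 1 * (norm \<xi>)\<^sup>2 + axis i 1 \<bullet> \<xi>)))"
      by (rule exp_quadratic.base) simp
    from exp_quadratic.add[OF this insert.IH] insert.hyps show ?case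
      by (simp add: inner_axis' mult.commute)
  qed
  have d: "exp_quadratic 0 (\<lambda>\<xi>::real^'n. complex_of_real (f (0, 1)) * complex_of_real (exp (- 1 * (norm \<xi>)\<^sup>2 + 0 \<bullet> \<xi>)))"
    by (rule exp_quadratic.base) simp
  have e: "f (v, s) = (\<Sum>i\<in>UNIV. v $ i * f (axis i 1, 0)) + f (0, 1) * s" for v s
  proof -
    have v: "(v, s) = (\<Sum>i\<in>UNIV. (v $ i) *\<^sub>R (axis i 1, 0)) + s *\<^sub>R (0, 1)"
    proof -
      have "(\<Sum>i\<in>UNIV. (v $ i) *\<^sub>R (axis i 1, 0::real)) = (\<Sum>i\<in>UNIV. (v $ i) *\<^sub>R axis i 1, 0)"
        by (simp add: prod_eq_iff fst_sum snd_sum)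
      also have "(\<Sum>i\<in>UNIV. (v $ i) *\<^sub>R axis i 1) = v"
        using basis_expansion[of v] by (simp add: scalar_mult_eq_scaleR)
      finally show ?thesis by simp
    qed
    show ?thesis by (subst v) (simp only: add sum scaleR real_scaleR_def mult.commute[of s])
  qed
  show ?case using exp_quadratic.add[OF c[OF finite] d] by (subst e) simp
next
  case (const c)
  show ?case using exp_quadratic.base[of 0 0 "complex_of_real c" 0] by simp
next
  case (add f g)
  then show ?case using exp_quadratic.add by simp
next
  case (mult f g)
  then show ?case using exp_quadratic_mult[of 0 _ 0] by simp
qed

text \<open>
  Stone--Weierstrass on the one-point compactification: the map \<open>\<Phi>\<close> embeds
  the frequency space into Euclidean space, tends to \<open>0\<close> at infinity, and polynomials in
  its components lie in the span of exponentials.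
\<close>

lemma exp_quadratic_dense_real:
  fixes h :: "real^'n \<Rightarrow> real"
  assumes cont: "continuous_on UNIV h" and supp: "\<And>\<xi>. norm \<xi> \<ge> R \<Longrightarrow> h \<xi> = 0" and e: "\<epsilon> > 0"
  shows "\<exists>g. exp_quadratic 0 (\<lambda>\<xi>. complex_of_real (g \<xi>)) \<and> (\<forall>\<xi>. \<bar>h \<xi> - g \<xi>\<bar> < \<epsilon>)"
proof -
  define \<Phi> where "\<Phi> = (\<lambda>\<xi>::real^'n. (\<chi> i. exp (- (norm \<xi>)\<^sup>2 + \<xi> $ i), exp (- (norm \<xi>)\<^sup>2)))"
  define K where "K = insert 0 (range \<Phi>)"
  \<comment> \<open>\<open>H\<close> is \<open>h\<close> transported to the image: the quotient of
    the i-th coordinate by the last one is exp (\<xi> $ i), so logarithms recover \<xi>. The last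
    coordinate vanishes only at the added point 0.\<close>
  define H where "H = (\<lambda>z::(real^'n)\<times>real. if snd z > 0 then h (\<chi> i. ln (fst z $ i / snd z)) else 0)"
  have H\<Phi>: "H (\<Phi> \<xi>) = h \<xi>" for \<xi>
  proof -
    have "exp (- (norm \<xi>)\<^sup>2 + t) / exp (- (norm \<xi>)\<^sup>2) = exp t" for t
      by (simp flip: exp_diff)
    then show ?thesis by (simp add: H_def \<Phi>_def del: exp_minus)
  qed
  have cont\<Phi>: "continuous_on UNIV \<Phi>"
    unfolding \<Phi>_def by (intro continuous_intros)
  have n\<Phi>: "norm (\<Phi> \<xi>) \<le> real (CARD('n)+1) * exp (1 - norm \<xi> ^ 2 / 2)" for \<xi>
  proof -
    \<comment> \<open>Half of the quadratic term absorbs the linear one, since |\<xi>| \<le> (1 +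
      |\<xi>|^2) / 2.\<close>
    have le: "- (norm \<xi>)\<^sup>2 + t \<le> 1 - norm \<xi> ^ 2 / 2" if "\<bar>t\<bar> \<le> norm \<xi>" for t
    proof -
      have "0 \<le> (norm \<xi> - 1)\<^sup>2" by simp
      then show ?thesis using that by (simp add: power2_eq_square algebra_simps)
    qed
    have "norm (\<Phi> \<xi>) \<le> norm (fst (\<Phi> \<xi>)) + norm (snd (\<Phi> \<xi>))"
      by (simp add: \<Phi>_def norm_Pair sqrt_sum_squares_le_sum)
    also have "norm (snd (\<Phi> \<xi>)) \<le> exp (1 - norm \<xi> ^ 2 / 2)"
      using le[of 0] by (simp add: \<Phi>_def)
    also have "norm (fst (\<Phi> \<xi>)) \<le> (\<Sum>i\<in>UNIV. \<bar>fst (\<Phi> \<xi>) $ i\<bar>)"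
      by (rule norm_le_l1_cart)
    also have "\<dots> \<le> (\<Sum>i\<in>(UNIV::'n set). exp (1 - norm \<xi> ^ 2 / 2))"
    proof (rule sum_mono)
      fix i
      show "\<bar>fst (\<Phi> \<xi>) $ i\<bar> \<le> exp (1 - norm \<xi> ^ 2 / 2)"
        using le[OF component_le_norm_cart[of \<xi> i]] by (simp add: \<Phi>_def)
    qed
    finally show ?thesis by (simp add: algebra_simps)
  qed
  have tends: "(\<Phi> \<longlongrightarrow> 0) at_infinity"
  proof (rule Lim_null_comparison)
    show "\<forall>\<^sub>F \<xi> in at_infinity. norm (\<Phi> \<xi>) \<le> real (CARD('n)+1) * exp (1 - norm \<xi> ^ 2 / 2)"
      using n\<Phi> by simp
    have "((\<lambda>r::real. real (CARD('n)+1) * exp (1 - r ^ 2 / 2)) \<longlongrightarrow> 0) at_top"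
      by real_asymp
    then show "((\<lambda>\<xi>::real^'n. real (CARD('n)+1) * exp (1 - norm \<xi> ^ 2 / 2)) \<longlongrightarrow> 0) at_infinity"
      by (rule filterlim_compose) (rule filterlim_norm_at_top)
  qed
  \<comment> \<open>Points of \<open>K\<close> with small last coordinate come from large
    frequencies, outside the support of \<open>h\<close>. So \<open>H\<close> vanishes on a whole
    neighbourhood of 0 in \<open>K\<close>, which gives continuity at the added point.\<close>
  have H0: "\<exists>\<delta>>0. \<forall>z\<in>K. snd z < \<delta> \<longrightarrow> H z = 0"
  proof (intro exI[of _ "exp (- R\<^sup>2)"] conjI ballI impI)
    fix z assume z: "z \<in> K" "snd z < exp (- R\<^sup>2)"
    show "H z = 0"
    proof (cases "z = 0")
      case False
      then obtain \<xi> where \<xi>: "z = \<Phi> \<xi>" using z by (auto simp: K_def)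
      with z have "R\<^sup>2 < (norm \<xi>)\<^sup>2" by (simp add: \<Phi>_def)
      then have "norm \<xi> \<ge> R" by (meson norm_ge_zero power2_less_imp_less less_imp_le)
      then show ?thesis using supp H\<Phi> \<xi> by simp
    qed (simp add: H_def)
  qed simp
  \<comment> \<open>A member of the cover containing 0 also contains the image of the exterior of
    some ball, and the image of the ball itself is compact.\<close>
  have compact: "compact K"
  proof (rule compactI)
    fix \<C> assume \<C>: "\<forall>t\<in>\<C>. open t" "K \<subseteq> \<Union>\<C>"
    then obtain U where U: "U \<in> \<C>" "0 \<in> U" "open U" by (auto simp: K_def)
    from topological_tendstoD[OF tends U(3,2)] obtain r where r: "\<And>\<xi>. norm \<xi> \<ge> r \<Longrightarrow> \<Phi> \<xi> \<in> U"
      unfolding eventually_at_infinity by blast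
    have "compact (\<Phi> ` cball 0 r)"
      by (intro compact_continuous_image continuous_on_subset[OF cont\<Phi>]) auto
    moreover have "\<Phi> ` cball 0 r \<subseteq> \<Union>\<C>" using \<C> by (auto simp: K_def)
    ultimately obtain \<D> where \<D>: "\<D> \<subseteq> \<C>" "finite \<D>" "\<Phi> ` cball 0 r \<subseteq> \<Union>\<D>"
      using \<C>(1) by (meson compactE)
    have "K \<subseteq> \<Union>(insert U \<D>)"
    proof
      fix z assume "z \<in> K"
      then consider "z = 0" | \<xi> where "z = \<Phi> \<xi>" by (auto simp: K_def)
      then show "z \<in> \<Union>(insert U \<D>)"
      proof cases
        case 1 with U show ?thesis by auto
      next
        case 2
        show ?thesis
        proof (cases "norm \<xi> \<ge> r")
          case False
          then have "z \<in> \<Phi> ` cball 0 r" using 2 by auto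
          with \<D> show ?thesis by auto
        qed (use r 2 in auto)
      qed
    qed
    then show "\<exists>\<C>'\<subseteq>\<C>. finite \<C>' \<and> K \<subseteq> \<Union>\<C>'"
      using U \<D> by (intro exI[of _ "insert U \<D>"]) auto
  qed
  have contH: "continuous_on K H"
    unfolding continuous_on_eq_continuous_within
  proof
    fix z assume z: "z \<in> K"
    obtain \<delta> where \<delta>: "\<delta> > 0" "\<And>z. z \<in> K \<Longrightarrow> snd z < \<delta> \<Longrightarrow> H z = 0" using H0 by blast
    show "continuous (at z within K) H"
    proof (cases "snd z < \<delta>")
      case True
      have "\<forall>\<^sub>F w in at z within K. snd w < \<delta>"
        by (rule order_tendstoD(2)[OF _ True]) (auto intro!: tendsto_intros)
      moreover have "\<forall>\<^sub>F w in at z within K. w \<in> K"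
        by (simp add: eventually_at_filter)
      ultimately have "\<forall>\<^sub>F w in at z within K. H w = 0"
        by eventually_elim (use \<delta> in auto)
      then have "(H \<longlongrightarrow> 0) (at z within K)" by (rule tendsto_eventually)
      then show ?thesis using \<delta>(2)[OF z True] by (simp add: continuous_within)
    next
      case False
      then have pos: "snd z > 0" using \<delta>(1) by simp
      then obtain \<xi> where \<xi>: "z = \<Phi> \<xi>" using z by (auto simp: K_def)
      have fz: "fst z $ i > 0" for i by (simp add: \<xi> \<Phi>_def)
      have h: "isCont h x" for x using cont by (simp add: continuous_on_eq_continuous_at)
      have "((\<lambda>w. h (\<chi> i. ln (fst w $ i / snd w))) \<longlongrightarrow> h (\<chi> i. ln (fst z $ i / snd z))) (at z within K)"
        using fz pos
        by (intro isCont_tendsto_compose[OF h] tendsto_vec_lambda tendsto_ln tendsto_divide tendsto_vec_nth tendsto_fst tendsto_snd tendsto_ident_at)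
           (auto simp: less_imp_neq[THEN not_sym])
      moreover have "\<forall>\<^sub>F w in at z within K. h (\<chi> i. ln (fst w $ i / snd w)) = H w"
      proof -
        have "\<forall>\<^sub>F w in at z within K. snd w > 0"
          by (rule order_tendstoD(1)[OF _ pos]) (auto intro!: tendsto_intros)
        then show ?thesis by eventually_elim (simp add: H_def)
      qed
      ultimately have "(H \<longlongrightarrow> h (\<chi> i. ln (fst z $ i / snd z))) (at z within K)"
        by (rule Lim_transform_eventually)
      then show ?thesis using pos by (simp add: continuous_within H_def)
    qed
  qed
  obtain P where P: "real_polynomial_function P" "\<And>z. z \<in> K \<Longrightarrow> \<bar>H z - P z\<bar> < \<epsilon>"
    using Stone_Weierstrass_real_polynomial_function[OF compact contH e] by blast
  show ?thesis
  proof (intro exI conjI allI)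
    show "exp_quadratic 0 (\<lambda>\<xi>. complex_of_real (P (\<Phi> \<xi>)))"
      unfolding \<Phi>_def by (rule exp_quadratic_real_polynomial[OF P(1)])
    show "\<bar>h \<xi> - P (\<Phi> \<xi>)\<bar> < \<epsilon>" for \<xi>
      using P(2)[of "\<Phi> \<xi>"] by (simp add: H\<Phi> K_def)
  qed
qed

text \<open>Approximate h times exp (|\<xi>|^2), which is still continuous with bounded support, and
  multiply the approximant by exp (- |\<xi>|^2). The uniform error becomes a Gaussian one, small in
  every weighted L^2 norm, and the rate rises from 0 to 1.\<close>

lemma exp_quadratic_dense:
  fixes h :: "real^'n \<Rightarrow> complex"
  assumes cont: "continuous_on UNIV h" and supp: "\<And>\<xi>. norm \<xi> \<ge> R \<Longrightarrow> h \<xi> = 0" and e: "\<epsilon> > 0"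
  shows "\<exists>g. exp_quadratic 1 g \<and> (\<forall>\<xi>. cmod (h \<xi> - g \<xi>) \<le> \<epsilon> * exp (- (norm \<xi>)\<^sup>2))"
proof -
  define q where "q = (\<lambda>\<xi>::real^'n. exp ((norm \<xi>)\<^sup>2))"
  have e2: "\<epsilon> / 2 > 0" using e by simp
  have cq: "continuous_on UNIV (\<lambda>\<xi>. F (h \<xi>) * q \<xi>)" if "bounded_linear F" for F :: "complex \<Rightarrow> real"
    unfolding q_def by (intro continuous_intros bounded_linear.continuous_on[OF that] cont)
  obtain g1 where g1: "exp_quadratic 0 (\<lambda>\<xi>::real^'n. complex_of_real (g1 \<xi>))"
      "\<And>\<xi>. \<bar>Re (h \<xi>) * q \<xi> - g1 \<xi>\<bar> < \<epsilon> / 2"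
    using exp_quadratic_dense_real[OF cq[OF bounded_linear_Re] _ e2, of R] by (auto simp: supp)
  obtain g2 where g2: "exp_quadratic 0 (\<lambda>\<xi>::real^'n. complex_of_real (g2 \<xi>))"
      "\<And>\<xi>. \<bar>Im (h \<xi>) * q \<xi> - g2 \<xi>\<bar> < \<epsilon> / 2"
    using exp_quadratic_dense_real[OF cq[OF bounded_linear_Im] _ e2, of R] by (auto simp: supp)
  define g where "g = (\<lambda>\<xi>::real^'n. Complex (g1 \<xi>) (g2 \<xi>) * complex_of_real (exp (- (norm \<xi>)\<^sup>2)))"
  have g_eq: "g = (\<lambda>\<xi>. complex_of_real (g1 \<xi>) * (1 * complex_of_real (exp (- 1 * (norm \<xi>)\<^sup>2 + 0 \<bullet> \<xi>)))
              + complex_of_real (g2 \<xi>) * (\<i> * complex_of_real (exp (- 1 * (norm \<xi>)\<^sup>2 + 0 \<bullet> \<xi>))))"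
    by (simp add: g_def fun_eq_iff complex_eq_iff)
  have b: "exp_quadratic 1 (\<lambda>\<xi>::real^'n. c * complex_of_real (exp (- 1 * (norm \<xi>)\<^sup>2 + 0 \<bullet> \<xi>)))" for c
    by (rule exp_quadratic.base) simp
  have "exp_quadratic 1 g"
    unfolding g_eq
    using exp_quadratic_mult[OF g1(1) b[of 1]] exp_quadratic_mult[OF g2(1) b[of \<i>]]
    by (intro exp_quadratic.add) simp_all
  moreover have "cmod (h \<xi> - g \<xi>) \<le> \<epsilon> * exp (- (norm \<xi>)\<^sup>2)" for \<xi>
  proof -
    have "h \<xi> = h \<xi> * complex_of_real (q \<xi>) * complex_of_real (exp (- (norm \<xi>)\<^sup>2))"
      by (simp add: q_def mult.assoc flip: of_real_mult exp_add)
    then have "h \<xi> - g \<xi> = (h \<xi> * complex_of_real (q \<xi>) - Complex (g1 \<xi>) (g2 \<xi>)) * complex_of_real (exp (- (norm \<xi>)\<^sup>2))"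
      by (metis g_def left_diff_distrib)
    moreover have "cmod (h \<xi> * complex_of_real (q \<xi>) - Complex (g1 \<xi>) (g2 \<xi>)) \<le> \<epsilon>"
      using cmod_le[of "h \<xi> * complex_of_real (q \<xi>) - Complex (g1 \<xi>) (g2 \<xi>)"] g1(2)[of \<xi>] g2(2)[of \<xi>]
      by simp
    ultimately show ?thesis by (simp add: norm_mult)
  qed
  ultimately show ?thesis by blast
qed

subsection \<open>Oscillatory integrals along dyadic paths\<close>

lemma continuous_on_integral_dominated:
  fixes f :: "'a::{first_countable_topology, t2_space} \<Rightarrow> 'b \<Rightarrow> 'c::{banach, second_countable_topology}"
  assumes "\<And>x. f x \<in> borel_measurable M" and cont: "\<And>\<omega>. continuous_on UNIV (\<lambda>x. f x \<omega>)"
    and "integrable M w" and "\<And>x \<omega>. norm (f x \<omega>) \<le> w \<omega>"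
  shows "continuous_on UNIV (\<lambda>x. \<integral>\<omega>. f x \<omega> \<partial>M)"
proof (rule continuous_on_sequentiallyI)
  fix u :: "nat \<Rightarrow> 'a" and a assume u: "u \<longlonglongrightarrow> a"
  show "(\<lambda>n. \<integral>\<omega>. f (u n) \<omega> \<partial>M) \<longlonglongrightarrow> (\<integral>\<omega>. f a \<omega> \<partial>M)"
  proof (rule integral_dominated_convergence[where w=w])
    show "AE \<omega> in M. (\<lambda>n. f (u n) \<omega>) \<longlonglongrightarrow> f a \<omega>"
      using continuous_on_tendsto_compose[OF cont u] by simp
  qed (use assms in auto)
qed

text \<open>
  On \<open>[0,1)\<close> the path is the sum of those \<open>s\<^sub>j\<close> for which the
  \<open>j\<close>-th binary digit of \<open>t\<close> is 1; this makes \<open>osc\<close> below a Riesz product.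
\<close>

fun dyadic_path :: "real list \<Rightarrow> real \<Rightarrow> real" where
  "dyadic_path [] t = 0"
| "dyadic_path (s # ss) t = (if t < 1/2 then dyadic_path ss (2 * t) else s + dyadic_path ss (2 * t - 1))"

lemma dyadic_path_measurable [measurable]: "dyadic_path ss \<in> borel_measurable borel"
proof (induction ss)
  case Nil
  have "dyadic_path [] = (\<lambda>_. 0)" by (simp add: fun_eq_iff)
  then show ?case by simp
next
  case (Cons s ss)
  note [measurable] = Cons
  have "dyadic_path (s # ss) = (\<lambda>t. if t < 1/2 then dyadic_path ss (2 * t) else s + dyadic_path ss (2 * t - 1))"
    by (simp add: fun_eq_iff)
  then show ?case by simp
qed

text \<open>The G of the overview, with \<open>\<beta>\<close> standing for norm \<xi> powr a and
  \<open>\<kappa>\<close> for \<xi> $ i. They are independent parameters because passing to a half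
  interval halves \<open>\<beta>\<close> and keeps \<open>\<kappa>\<close>.\<close>

definition osc :: "real list \<Rightarrow> real \<Rightarrow> real \<Rightarrow> complex" where
  "osc ss \<beta> \<kappa> = (\<integral>t. indicator {0..<1} t *\<^sub>R cis (\<beta> * t + \<kappa> * dyadic_path ss t) \<partial>lborel)"

lemma integrable_osc: "integrable lborel (\<lambda>t. indicator {0..<1::real} t *\<^sub>R cis (\<beta> * t + \<kappa> * dyadic_path ss t))"
  by (rule Bochner_Integration.integrable_bound[where f="indicat_real {0..<1}"]) (auto simp: cis_conv_exp)

lemma continuous_on_osc: "continuous_on UNIV (\<lambda>(\<beta>, \<kappa>). osc ss \<beta> \<kappa>)"
  unfolding osc_def case_prod_beta'
  by (rule continuous_on_integral_dominated[where w="indicat_real {0..<1}"])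
     (auto simp: cis_conv_exp intro!: continuous_intros)

lemma one_plus_cos_nonneg: "0 \<le> 1 + cos (x::real)"
  using cos_ge_minus_one[of x] by linarith

lemma cis_half: "(cmod ((1 + cis \<theta>) / 2))\<^sup>2 = (1 + cos \<theta>) / 2"
proof -
  have "(cmod (1 + cis \<theta>))\<^sup>2 = (1 + cos \<theta>)\<^sup>2 + (sin \<theta>)\<^sup>2" by (simp add: cmod_power2)
  also have "\<dots> = 2 * (1 + cos \<theta>)"
    by (simp add: sin_squared_eq) (simp add: power2_eq_square algebra_simps)
  finally show ?thesis by (simp add: norm_divide power_divide)
qed

text \<open>Split at 1/2 and rescale both halves to the unit interval. The right half repeats the
  left one with the path shifted by \<open>s\<close> and the time by 1/2, hence with one extra
  constant phase.\<close>

lemma osc_Cons: "osc (s # ss) \<beta> \<kappa> = (1 + cis (\<beta> / 2 + \<kappa> * s)) / 2 * osc ss (\<beta> / 2) \<kappa>"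
proof -
  define f where "f = (\<lambda>t. cis (\<beta> * t + \<kappa> * dyadic_path (s # ss) t))"
  define g where "g = (\<lambda>t. indicator {0..<1::real} t *\<^sub>R cis (\<beta> / 2 * t + \<kappa> * dyadic_path ss t))"
  have [measurable]: "f \<in> borel_measurable borel" unfolding f_def cis_conv_exp by measurable
  have nf: "cmod (f t) = 1" for t by (simp add: f_def)
  have fint: "integrable lborel (\<lambda>t. indicator {a..<b::real} t *\<^sub>R f t)" if "0 \<le> a" "b \<le> 1" for a b
    by (rule Bochner_Integration.integrable_bound[where f="indicat_real {0..<1}"])
       (use that in \<open>auto simp: nf indicator_def\<close>)
  have "osc (s # ss) \<beta> \<kappa> = (\<integral>t. indicator {0..<1/2} t *\<^sub>R f t + indicator {1/2..<1} t *\<^sub>R f t \<partial>lborel)"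
    unfolding osc_def f_def[symmetric]
    by (intro Bochner_Integration.integral_cong refl) (auto simp: f_def indicator_def)
  also have "\<dots> = (\<integral>t. indicator {0..<1/2} t *\<^sub>R f t \<partial>lborel) + (\<integral>t. indicator {1/2..<1} t *\<^sub>R f t \<partial>lborel)"
    by (intro Bochner_Integration.integral_add fint) auto
  also have "(\<integral>t. indicator {0..<1/2} t *\<^sub>R f t \<partial>lborel) = (1/2) *\<^sub>R (\<integral>t. g t \<partial>lborel)"
    by (subst lborel_integral_real_affine[where c="1/2" and t=0])
       (auto simp: f_def g_def indicator_def intro!: Bochner_Integration.integral_cong)
  also have "(\<integral>t. indicator {1/2..<1} t *\<^sub>R f t \<partial>lborel) = (1/2) *\<^sub>R (\<integral>t. cis (\<beta> / 2 + \<kappa> * s) * g t \<partial>lborel)"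
    by (subst lborel_integral_real_affine[where c="1/2" and t="1/2"])
       (auto simp: f_def g_def indicator_def cis_mult algebra_simps intro!: Bochner_Integration.integral_cong)
  also have "(\<integral>t. cis (\<beta> / 2 + \<kappa> * s) * g t \<partial>lborel) = cis (\<beta> / 2 + \<kappa> * s) * (\<integral>t. g t \<partial>lborel)"
    by simp
  also have "(\<integral>t. g t \<partial>lborel) = osc ss (\<beta> / 2) \<kappa>" by (simp add: g_def osc_def)
  finally show ?thesis by (simp add: scaleR_conv_of_real algebra_simps add_divide_distrib)
qed

lemma osc_Cons_sq: "(cmod (osc (s # ss) \<beta> \<kappa>))\<^sup>2 = (1 + cos (\<beta> / 2 + \<kappa> * s)) / 2 * (cmod (osc ss (\<beta> / 2) \<kappa>))\<^sup>2"
  unfolding osc_Cons norm_mult power_mult_distrib cis_half ..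

text \<open>A step of size 0 leaves the zero path unchanged. This writes the integral without a path
  in the same product form as \<open>osc_mean\<close>, so that the two can be compared factor by
  factor.\<close>

lemma osc_Nil_double: "(cmod (osc [] \<beta> \<kappa>))\<^sup>2 = (1 + cos (\<beta> / 2)) / 2 * (cmod (osc [] (\<beta> / 2) \<kappa>))\<^sup>2"
proof -
  have "osc [0] \<beta> \<kappa> = osc [] \<beta> \<kappa>" by (simp add: osc_def cong: if_cong)
  with osc_Cons_sq[of 0 "[]" \<beta> \<kappa>] show ?thesis by simp
qed

text \<open>The phase stays within one radian, less than pi / 3, so the real part of the integrand
  is at least 1/2.\<close>

lemma osc_Nil_lower:
  assumes "\<bar>\<beta>\<bar> \<le> 1"
  shows "(cmod (osc [] \<beta> \<kappa>))\<^sup>2 \<ge> 1 / 4"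
proof -
  have half: "cos (\<beta> * t) \<ge> 1 / 2" if "t \<in> {0..<1}" for t
  proof -
    have b: "\<bar>\<beta> * t\<bar> \<le> 1" using assms that by (simp add: abs_mult mult_le_one)
    have "cos (pi / 3) \<le> cos \<bar>\<beta> * t\<bar>"
      by (rule cos_monotone_0_pi_le) (use b pi_gt3 in auto)
    then show ?thesis by (simp add: cos_60)
  qed
  have "1 / 2 = (\<integral>t. indicator {0..<1} t *\<^sub>R (1/2) \<partial>(lborel::real measure))"
    by simp
  also have "\<dots> \<le> (\<integral>t. indicator {0..<1::real} t *\<^sub>R cos (\<beta> * t) \<partial>lborel)"
  proof (rule integral_mono)
    show "integrable lborel (\<lambda>t. indicator {0..<1::real} t *\<^sub>R cos (\<beta> * t))"
      by (rule Bochner_Integration.integrable_bound[where f="indicat_real {0..<1}"]) 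
         (auto simp: indicator_def)
    show "integrable lborel (\<lambda>t. indicator {0..<1::real} t *\<^sub>R (1 / 2 :: real))"
      by (intro integrable_scaleR_left) simp
  qed (use half in \<open>auto simp: indicator_def\<close>)
  also have "\<dots> = (\<integral>t. Re (indicator {0..<1::real} t *\<^sub>R cis (\<beta> * t + \<kappa> * dyadic_path [] t)) \<partial>lborel)"
    by simp
  also have "\<dots> = Re (osc [] \<beta> \<kappa>)"
    unfolding osc_def by (rule integral_Re[OF integrable_osc])
  also have "\<dots> \<le> cmod (osc [] \<beta> \<kappa>)" by (rule complex_Re_le_cmod)
  finally have "(1/2)\<^sup>2 \<le> (cmod (osc [] \<beta> \<kappa>))\<^sup>2" by (intro power_mono) auto
  then show ?thesis by (simp add: power2_eq_square)
qed

text \<open>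
  The expectation of \<open>(cmod (osc ss \<beta> \<kappa>))\<^sup>2\<close> for independent centred
  Gaussian \<open>s\<^sub>j\<close> with standard deviations \<open>\<sigma>\<^sub>j\<close>.
\<close>

fun osc_mean :: "real list \<Rightarrow> real \<Rightarrow> real \<Rightarrow> real" where
  "osc_mean [] \<beta> \<kappa> = (cmod (osc [] \<beta> \<kappa>))\<^sup>2"
| "osc_mean (\<sigma> # \<sigma>s) \<beta> \<kappa> = (1 + cos (\<beta> / 2) * exp (- (\<sigma> * \<kappa>)\<^sup>2 / 2)) / 2 * osc_mean \<sigma>s (\<beta> / 2) \<kappa>"

lemma osc_measurable [measurable]: "(\<lambda>z. osc ss (fst z) (snd z)) \<in> borel_measurable borel"
  using borel_measurable_continuous_onI[OF continuous_on_osc[of ss]] by (simp add: case_prod_beta')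

lemma osc_measurable' [measurable]:
  assumes [measurable]: "\<beta> \<in> borel_measurable M" "\<kappa> \<in> borel_measurable M"
  shows "(\<lambda>x. osc ss (\<beta> x) (\<kappa> x)) \<in> borel_measurable M"
  using measurable_compose[OF _ osc_measurable, of "\<lambda>x. (\<beta> x, \<kappa> x)" M ss] by simp

lemma osc_mean_measurable [measurable]:
  assumes "\<beta> \<in> borel_measurable M" and [measurable]: "\<kappa> \<in> borel_measurable M"
  shows "(\<lambda>x. osc_mean \<sigma>s (\<beta> x) (\<kappa> x)) \<in> borel_measurable M"
  using assms(1)
proof (induction \<sigma>s arbitrary: \<beta>)
  case Nil
  note [measurable] = Nil
  show ?case by simp
next
  case (Cons \<sigma> \<sigma>s)
  note [measurable] = Cons.prems
  have [measurable]: "(\<lambda>x. osc_mean \<sigma>s (\<beta> x / 2) (\<kappa> x)) \<in> borel_measurable M"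
    by (rule Cons.IH) measurable
  show ?case by simp
qed

lemma abs_cos_exp_le: "\<bar>cos x * exp (- y\<^sup>2 / 2)\<bar> \<le> (1::real)"
  unfolding abs_mult by (rule mult_le_one) auto

lemma osc_mean_nonneg: "osc_mean \<sigma>s \<beta> \<kappa> \<ge> 0"
proof (induction \<sigma>s arbitrary: \<beta>)
  case (Cons \<sigma> \<sigma>s)
  have "1 + cos (\<beta> / 2) * exp (- (\<sigma> * \<kappa>)\<^sup>2 / 2) \<ge> 0"
    using abs_cos_exp_le[of "\<beta> / 2" "\<sigma> * \<kappa>"] by linarith
  then show ?case using Cons[of "\<beta> / 2"] by simp
qed simp

section \<open>Selecting a path by averaging over Gaussian steps\<close>

text \<open>The real part of the characteristic function supplies the damping factor. This turns one
  random factor of \<open>osc_Cons_sq\<close> into one factor of \<open>osc_mean\<close>.\<close>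

lemma std_normal_mean_cos:
  "(\<integral>\<^sup>+x. ennreal ((1 + cos (\<theta> + \<tau> * x)) / 2) \<partial>std_normal_distribution)
   = ennreal ((1 + cos \<theta> * exp (- \<tau>\<^sup>2 / 2)) / 2)"
proof -
  interpret N: prob_space std_normal_distribution
    by (rule prob_space_normal_density) simp
  have i1: "integrable std_normal_distribution (\<lambda>x. iexp (\<theta> + \<tau> * x))"
    by (rule N.integrable_const_bound[where B=1]) auto
  have i2: "integrable std_normal_distribution (\<lambda>x. cos (\<theta> + \<tau> * x))"
    by (rule N.integrable_const_bound[where B=1]) auto
  have "(\<integral>x. cos (\<theta> + \<tau> * x) \<partial>std_normal_distribution) = Re (\<integral>x. iexp (\<theta> + \<tau> * x) \<partial>std_normal_distribution)"
    by (subst integral_Re[OF i1, symmetric]) (simp only: cis_conv_exp[symmetric] cis.sel)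
  also have "(\<integral>x. iexp (\<theta> + \<tau> * x) \<partial>std_normal_distribution) = (\<integral>x. iexp \<theta> * iexp (\<tau> * x) \<partial>std_normal_distribution)"
    by (intro Bochner_Integration.integral_cong refl) (simp add: exp_add distrib_left)
  also have "\<dots> = iexp \<theta> * char std_normal_distribution \<tau>"
    unfolding char_def by (rule integral_mult_right_zero)
  also have "Re \<dots> = cos \<theta> * exp (- \<tau>\<^sup>2 / 2)"
    unfolding char_std_normal_distribution cis_conv_exp[symmetric] by simp
  finally have "(\<integral>x. (1 + cos (\<theta> + \<tau> * x)) / 2 \<partial>std_normal_distribution) = (1 + cos \<theta> * exp (- \<tau>\<^sup>2 / 2)) / 2"
    using i2 N.prob_space by simp
  moreover have "(\<integral>\<^sup>+x. ennreal ((1 + cos (\<theta> + \<tau> * x)) / 2) \<partial>std_normal_distribution)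
      = ennreal (\<integral>x. (1 + cos (\<theta> + \<tau> * x)) / 2 \<partial>std_normal_distribution)"
    by (rule nn_integral_eq_integral) (use i2 one_plus_cos_nonneg in auto)
  ultimately show ?thesis by (simp only:)
qed

text \<open>The steps are fixed one at a time, so no joint distribution of all of them appears. The
  weight \<open>W\<close> is arbitrary because the factor of a step that has been fixed is moved
  into it for the rest of the induction.\<close>

lemma exists_path_ge_mean:
  fixes M :: "'a measure" and W :: "'a \<Rightarrow> ennreal"
  assumes "sigma_finite_measure M" and "W \<in> borel_measurable M" "\<beta> \<in> borel_measurable M" "\<kappa> \<in> borel_measurable M"
    and "(\<integral>\<^sup>+\<omega>. W \<omega> * ennreal (osc_mean \<sigma>s (\<beta> \<omega>) (\<kappa> \<omega>)) \<partial>M) < \<infinity>"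
  shows "\<exists>ss. (\<integral>\<^sup>+\<omega>. W \<omega> * ennreal (osc_mean \<sigma>s (\<beta> \<omega>) (\<kappa> \<omega>)) \<partial>M)
              \<le> (\<integral>\<^sup>+\<omega>. W \<omega> * ennreal ((cmod (osc ss (\<beta> \<omega>) (\<kappa> \<omega>)))\<^sup>2) \<partial>M)"
  using assms(2,3,5)
proof (induction \<sigma>s arbitrary: W \<beta>)
  case Nil
  show ?case by (rule exI[of _ "[]"]) simp
next
  case (Cons \<sigma> \<sigma>s)
  interpret M: sigma_finite_measure M by fact
  interpret N: prob_space std_normal_distribution
    by (rule prob_space_normal_density) simp
  interpret P: pair_sigma_finite M std_normal_distribution ..
  note [measurable] = Cons.prems(1,2) assms(4)
  define c where "c = (\<lambda>\<omega> x. (1 + cos (\<beta> \<omega> / 2 + \<kappa> \<omega> * (\<sigma> * x))) / 2)"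
  define m where "m = (\<lambda>\<omega>. osc_mean \<sigma>s (\<beta> \<omega> / 2) (\<kappa> \<omega>))"
  \<comment> \<open>\<open>F x\<close> is the average that remains once the first step is fixed to
    \<open>\<sigma> * x\<close>; its mean over x is \<open>A\<close>.\<close>
  define F where "F = (\<lambda>x. \<integral>\<^sup>+\<omega>. W \<omega> * ennreal (c \<omega> x) * ennreal (m \<omega>) \<partial>M)"
  define A where "A = (\<integral>\<^sup>+\<omega>. W \<omega> * ennreal (osc_mean (\<sigma> # \<sigma>s) (\<beta> \<omega>) (\<kappa> \<omega>)) \<partial>M)"
  have c0: "0 \<le> c \<omega> x" for \<omega> x
    using one_plus_cos_nonneg[of "\<beta> \<omega> / 2 + \<kappa> \<omega> * (\<sigma> * x)"] by (simp add: c_def)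
  have [measurable]: "m \<in> borel_measurable M" unfolding m_def by measurable
  have cm[measurable]: "(\<lambda>(\<omega>, x). c \<omega> x) \<in> borel_measurable (M \<Otimes>\<^sub>M std_normal_distribution)"
    unfolding c_def by measurable
  have "(\<integral>\<^sup>+x. F x \<partial>std_normal_distribution)
      = (\<integral>\<^sup>+\<omega>. (\<integral>\<^sup>+x. W \<omega> * ennreal (c \<omega> x) * ennreal (m \<omega>) \<partial>std_normal_distribution) \<partial>M)"
    unfolding F_def by (rule P.Fubini') measurable
  also have "\<dots> = (\<integral>\<^sup>+\<omega>. W \<omega> * ennreal (m \<omega>) * (\<integral>\<^sup>+x. ennreal (c \<omega> x) \<partial>std_normal_distribution) \<partial>M)"
  proof (rule nn_integral_cong)
    fix \<omega> assume [measurable]: "\<omega> \<in> space M"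
    show "(\<integral>\<^sup>+x. W \<omega> * ennreal (c \<omega> x) * ennreal (m \<omega>) \<partial>std_normal_distribution)
       = W \<omega> * ennreal (m \<omega>) * (\<integral>\<^sup>+x. ennreal (c \<omega> x) \<partial>std_normal_distribution)"
      unfolding c_def by (subst nn_integral_cmult[symmetric]) (auto simp: mult_ac)
  qed
  also have "\<dots> = A"
    unfolding A_def
  proof (rule nn_integral_cong)
    fix \<omega>
    have e: "(\<integral>\<^sup>+x. ennreal (c \<omega> x) \<partial>std_normal_distribution)
        = ennreal ((1 + cos (\<beta> \<omega> / 2) * exp (- (\<sigma> * \<kappa> \<omega>)\<^sup>2 / 2)) / 2)"
      using std_normal_mean_cos[of "\<beta> \<omega> / 2" "\<kappa> \<omega> * \<sigma>"] by (simp add: c_def mult_ac)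
    have "0 \<le> 1 + cos (\<beta> \<omega> / 2) * exp (- (\<sigma> * \<kappa> \<omega>)\<^sup>2 / 2)"
      using abs_cos_exp_le[of "\<beta> \<omega> / 2" "\<sigma> * \<kappa> \<omega>"] by linarith
    then show "W \<omega> * ennreal (m \<omega>) * (\<integral>\<^sup>+x. ennreal (c \<omega> x) \<partial>std_normal_distribution)
        = W \<omega> * ennreal (osc_mean (\<sigma> # \<sigma>s) (\<beta> \<omega>) (\<kappa> \<omega>))"
      unfolding e mult.assoc
      by (subst ennreal_mult[symmetric]) (auto simp: m_def osc_mean_nonneg mult_ac)
  qed
  finally have FA: "(\<integral>\<^sup>+x. F x \<partial>std_normal_distribution) = A" .
  have Afin: "A < \<infinity>" using Cons.prems(3) by (simp only: A_def)
  have [measurable]: "F \<in> borel_measurable std_normal_distribution"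
    unfolding F_def c_def by measurable
  \<comment> \<open>The induction hypothesis needs a finite value, and \<open>F\<close> is finite
    only almost everywhere. If no finite value reached \<open>A\<close>, then \<open>F\<close> would
    be below \<open>A\<close> almost everywhere, and so would its mean.\<close>
  have "\<exists>x. F x < \<infinity> \<and> A \<le> F x"
  proof (rule ccontr)
    assume "\<not> ?thesis"
    then have no: "F x < A \<or> F x = \<infinity>" for x by (auto simp: not_le less_top)
    have "AE x in std_normal_distribution. F x \<noteq> \<infinity>"
      by (rule nn_integral_PInf_AE) (use FA Afin in \<open>auto simp: less_top[symmetric]\<close>)
    then have ae: "AE x in std_normal_distribution. F x < A"
      using no by (auto elim!: eventually_mono)
    have "(\<integral>\<^sup>+x. F x \<partial>std_normal_distribution) < (\<integral>\<^sup>+x. A \<partial>std_normal_distribution)"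
    proof (rule nn_integral_less)
      show "\<not> (AE x in std_normal_distribution. A \<le> F x)"
      proof
        assume "AE x in std_normal_distribution. A \<le> F x"
        with ae have "AE x in std_normal_distribution. False" by eventually_elim simp
        then show False using N.AE_False by simp
      qed
    qed (use ae FA Afin in \<open>auto intro: less_imp_le elim!: eventually_mono\<close>)
    with FA N.emeasure_space_1 show False by simp
  qed
  then obtain x where x: "F x < \<infinity>" "A \<le> F x" by blast
  have cx[measurable]: "(\<lambda>\<omega>. c \<omega> x) \<in> borel_measurable M" unfolding c_def by measurable
  obtain ss where ss: "F x \<le> (\<integral>\<^sup>+\<omega>. (W \<omega> * ennreal (c \<omega> x)) * ennreal ((cmod (osc ss (\<beta> \<omega> / 2) (\<kappa> \<omega>)))\<^sup>2) \<partial>M)"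
    using Cons.IH[of "\<lambda>\<omega>. W \<omega> * ennreal (c \<omega> x)" "\<lambda>\<omega>. \<beta> \<omega> / 2"] x(1)
    unfolding F_def m_def by auto
  have "(W \<omega> * ennreal (c \<omega> x)) * ennreal ((cmod (osc ss (\<beta> \<omega> / 2) (\<kappa> \<omega>)))\<^sup>2)
      = W \<omega> * ennreal ((cmod (osc ((\<sigma> * x) # ss) (\<beta> \<omega>) (\<kappa> \<omega>)))\<^sup>2)" for \<omega>
    unfolding osc_Cons_sq mult.assoc
    by (subst ennreal_mult[symmetric]) (use c0[of \<omega> x] in \<open>auto simp: c_def mult_ac\<close>)
  with ss x(2) show ?case unfolding A_def by (intro exI[of _ "(\<sigma> * x) # ss"]) simp
qed

section \<open>Lower bounds for the averaged Riesz product\<close>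

text \<open>For 0 < v \<le> 1 one has 1 + v cos \<ge> v (1 + cos). Each level thus loses at most its
  factor v against the integral without a path, which is efficient when the steps are small.\<close>

lemma osc_mean_lower_fine:
  "exp (- (\<Sum>\<sigma>\<leftarrow>\<sigma>s. (\<sigma> * \<kappa>)\<^sup>2 / 2)) * (cmod (osc [] \<beta> \<kappa>))\<^sup>2 \<le> osc_mean \<sigma>s \<beta> \<kappa>"
proof (induction \<sigma>s arbitrary: \<beta>)
  case (Cons \<sigma> \<sigma>s)
  define v where "v = exp (- (\<sigma> * \<kappa>)\<^sup>2 / 2)"
  define S where "S = exp (- (\<Sum>\<sigma>\<leftarrow>\<sigma>s. (\<sigma> * \<kappa>)\<^sup>2 / 2))"
  have v: "0 < v" "v \<le> 1" by (auto simp: v_def)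
  have c: "0 \<le> (1 + cos (\<beta> / 2)) / 2" using one_plus_cos_nonneg[of "\<beta> / 2"] by simp
  have vS: "exp (- (\<Sum>\<sigma>\<leftarrow>\<sigma> # \<sigma>s. (\<sigma> * \<kappa>)\<^sup>2 / 2)) = v * S"
    unfolding v_def S_def by (simp only: exp_add[symmetric]) simp
  have "exp (- (\<Sum>\<sigma>\<leftarrow>\<sigma> # \<sigma>s. (\<sigma> * \<kappa>)\<^sup>2 / 2)) * (cmod (osc [] \<beta> \<kappa>))\<^sup>2
     = v * ((1 + cos (\<beta> / 2)) / 2) * (S * (cmod (osc [] (\<beta> / 2) \<kappa>))\<^sup>2)"
    unfolding osc_Nil_double[of \<beta> \<kappa>] vS by (simp only: mult_ac)
  also have "\<dots> \<le> v * ((1 + cos (\<beta> / 2)) / 2) * osc_mean \<sigma>s (\<beta> / 2) \<kappa>"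
    unfolding S_def by (intro mult_left_mono Cons.IH mult_nonneg_nonneg) (use v c in auto)
  also have "\<dots> \<le> ((1 + cos (\<beta> / 2) * v) / 2) * osc_mean \<sigma>s (\<beta> / 2) \<kappa>"
    using v by (intro mult_right_mono osc_mean_nonneg) (auto simp: algebra_simps)
  finally show ?case by (simp add: v_def)
qed simp

text \<open>For v \<ge> 0 one has 1 + v cos \<ge> 1 - v, whatever the linear phase does. This is
  efficient when the steps are large and v is close to 0.\<close>

lemma osc_mean_lower_coarse:
  "(\<Prod>\<sigma>\<leftarrow>\<sigma>s. (1 - exp (- (\<sigma> * \<kappa>)\<^sup>2 / 2)) / 2) * osc_mean \<tau>s (\<beta> / 2 ^ length \<sigma>s) \<kappa> \<le> osc_mean (\<sigma>s @ \<tau>s) \<beta> \<kappa>"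
proof (induction \<sigma>s arbitrary: \<beta>)
  case (Cons \<sigma> \<sigma>s)
  define v where "v = exp (- (\<sigma> * \<kappa>)\<^sup>2 / 2)"
  have v: "0 < v" "v \<le> 1" by (auto simp: v_def)
  have c: "0 \<le> v * (1 + cos (\<beta> / 2))"
    using v one_plus_cos_nonneg[of "\<beta> / 2"] by simp
  have "(\<Prod>\<sigma>\<leftarrow>\<sigma> # \<sigma>s. (1 - exp (- (\<sigma> * \<kappa>)\<^sup>2 / 2)) / 2) * osc_mean \<tau>s (\<beta> / 2 ^ length (\<sigma> # \<sigma>s)) \<kappa>
     = (1 - v) / 2 * ((\<Prod>\<sigma>\<leftarrow>\<sigma>s. (1 - exp (- (\<sigma> * \<kappa>)\<^sup>2 / 2)) / 2) * osc_mean \<tau>s (\<beta> / 2 / 2 ^ length \<sigma>s) \<kappa>)"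
    by (simp add: v_def)
  also have "\<dots> \<le> (1 - v) / 2 * osc_mean (\<sigma>s @ \<tau>s) (\<beta> / 2) \<kappa>"
    by (intro mult_left_mono Cons.IH) (use v in auto)
  also have "\<dots> \<le> (1 + cos (\<beta> / 2) * v) / 2 * osc_mean (\<sigma>s @ \<tau>s) (\<beta> / 2) \<kappa>"
    by (intro mult_right_mono osc_mean_nonneg) (use c in \<open>simp add: algebra_simps\<close>)
  finally show ?case by (simp add: v_def)
qed simp

text \<open>
  At frequency scale \<open>\<rho> ^ J\<close> each coarse level contributes a factor close to
  \<open>1 / 2\<close>, because \<open>\<sigma>\<^sub>j * \<kappa>\<close> is large there, and all the fine
  levels together contribute a factor bounded below.
\<close>

lemma osc_mean_lower:
  assumes r: "\<rho> > 0" "\<rho>\<^sup>2 \<ge> 2" and J: "1 \<le> J" "J \<le> N"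
    and k: "\<rho> ^ J / 3 \<le> \<kappa>" "\<kappa> \<le> sqrt 2 * (\<rho> ^ J / 3)" and b: "\<bar>\<beta>\<bar> \<le> 2 ^ J"
  shows "exp (-4) / 8 / 2 ^ J \<le> osc_mean (map (\<lambda>j. 6 / \<rho> ^ j) [1..<Suc N]) \<beta> \<kappa>"
proof -
  \<comment> \<open>With the constant 6 and \<kappa> between \<rho> ^ J / 3 and sqrt 2 times that,
    \<sigma> j * \<kappa> is at least 2 * \<rho> ^ (J - j) on coarse levels and at most 2 * sqrt 2 /
    \<rho> ^ (j - J) on fine ones.\<close>
  define \<sigma> where "\<sigma> = (\<lambda>j. 6 / \<rho> ^ j)"
  define v where "v = (\<lambda>j. (\<sigma> j * \<kappa>)\<^sup>2 / 2)"
  have \<kappa>0: "\<kappa> > 0" using k(1) r(1) by (smt (verit) divide_pos_pos zero_less_power)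
  have split: "[1..<Suc N] = [1..<Suc J] @ [Suc J..<Suc N]"
    using J by (metis Suc_le_mono le_SucI upt_add_eq_append le_add_diff_inverse)
  have rk: "2 ^ k \<le> (\<rho> ^ k)\<^sup>2" for k
    using power_mono[OF r(2), of k] by (simp add: power_mult[symmetric] mult.commute)
  \<comment> \<open>With i = J - j, v j \<ge> 2 * 2 ^ i \<ge> 2 * (i + 1), and exp (-2) \<le>
    1/4.\<close>
  have coarse: "exp (- v j) \<le> (1 / 4) ^ Suc (J - j)" if "j \<in> {1..<Suc J}" for j
  proof -
    define i where "i = J - j"
    have Ji: "J = j + i" using that by (simp add: i_def)
    have "2 * \<rho> ^ i \<le> \<sigma> j * \<kappa>"
      using k(1) r(1) unfolding Ji \<sigma>_def by (simp add: field_simps power_add)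
    then have "(2 * \<rho> ^ i)\<^sup>2 \<le> (\<sigma> j * \<kappa>)\<^sup>2" using r(1) by (intro power_mono) auto
    then have "2 * (\<rho> ^ i)\<^sup>2 \<le> v j" by (simp add: v_def power_mult_distrib)
    with rk[of i] have "2 * 2 ^ i \<le> v j" by linarith
    moreover have "real (Suc i) \<le> 2 ^ i"
      by (metis Suc_leI less_exp of_nat_le_iff of_nat_numeral of_nat_power)
    then have "2 * real (Suc i) \<le> 2 * 2 ^ i" by (intro mult_left_mono) auto
    ultimately have "2 * real (Suc i) \<le> v j" by (metis order_trans)
    then have "exp (- v j) \<le> exp (- (2 * real (Suc i)))" by simp
    also have "\<dots> = exp (-2) ^ Suc i" by (simp only: exp_of_nat_mult[symmetric]) (simp add: algebra_simps)
    also have "\<dots> \<le> (1 / 4) ^ Suc i"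
    proof (rule power_mono)
      have "(2::real)\<^sup>2 \<le> (exp 1)\<^sup>2" using exp_ge_add_one_self[of 1] by (intro power_mono) auto
      also have "(exp 1)\<^sup>2 = exp (2::real)" by (simp add: exp_of_nat_mult[symmetric] flip: exp_double)
      finally show "exp (-2) \<le> (1/4::real)" by (simp add: exp_minus field_simps)
    qed simp
    finally show ?thesis by (simp add: i_def)
  qed
  have geo: "(\<Sum>i<n. (1 / 4) ^ Suc i) = (1 - (1 / 4) ^ n) / (3::real)" for n
  proof (induction n)
    case (Suc n)
    then show ?case by (simp only: sum.lessThan_Suc power_Suc) (simp add: field_split_simps)
  qed simp
  have geo2: "(\<Sum>i\<in>{1..<Suc n}. 4 * (1 / 2) ^ i) = 4 * (1 - (1 / 2) ^ n :: real)" for n :: nat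
    by (induction n) (auto simp: algebra_simps)
  \<comment> \<open>A sum bounded by 1/2 uniformly in J keeps the product of the 1 - exp (- v j)
    above 1/2, by the Weierstrass product inequality.\<close>
  have sumc: "(\<Sum>j\<in>{1..<Suc J}. exp (- v j)) \<le> 1 / 2"
  proof -
    have "(\<Sum>j\<in>{1..<Suc J}. exp (- v j)) \<le> (\<Sum>j\<in>{1..<Suc J}. (1 / 4) ^ Suc (J - j))"
      by (intro sum_mono coarse)
    also have "\<dots> = (\<Sum>i<J. (1 / 4) ^ Suc i)"
      by (rule sum.reindex_bij_witness[of _ "\<lambda>i. J - i" "\<lambda>j. J - j"]) auto
    also have "\<dots> = (1 - (1/4) ^ J) / 3"
      by (rule geo)
    also have "\<dots> \<le> 1 / 2"
    proof -
      have "(1 - q) / 3 \<le> 1 / 2" if "0 \<le> q" for q :: real using that by simp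
      from this[of "(1 / 4) ^ J"] show ?thesis by simp
    qed
    finally show ?thesis .
  qed
  have "(1 / 2) ^ J * (1 / 2) \<le> (1 / 2) ^ J * (1 - (\<Sum>j\<in>{1..<Suc J}. exp (- v j)))"
    using sumc by (intro mult_left_mono) auto
  also have "\<dots> \<le> (1 / 2) ^ J * (\<Prod>j\<in>{1..<Suc J}. 1 - exp (- v j))"
    by (intro mult_left_mono Weierstrass_prod_ineq) (auto simp: v_def)
  also have "\<dots> = (\<Prod>j\<in>{1..<Suc J}. (1 - exp (- v j)) / 2)"
    by (simp add: prod_dividef power_divide)
  also have "\<dots> = (\<Prod>\<sigma>\<leftarrow>map \<sigma> [1..<Suc J]. (1 - exp (- (\<sigma> * \<kappa>)\<^sup>2 / 2)) / 2)"
    unfolding atLeastLessThan_upt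
    by (subst prod.distinct_set_conv_list) (simp_all add: v_def o_def del: upt_Suc)
  finally have coarse': "(1 / 2) ^ J * (1 / 2) \<le> (\<Prod>\<sigma>\<leftarrow>map \<sigma> [1..<Suc J]. (1 - exp (- (\<sigma> * \<kappa>)\<^sup>2 / 2)) / 2)" .
  \<comment> \<open>These bounds sum to at most 4, so all fine levels together lose at most the
    factor exp (-4).\<close>
  have fine: "v j \<le> 4 * (1 / 2) ^ (j - J)" if "j \<in> {Suc J..<Suc N}" for j
  proof -
    define i where "i = j - J"
    have ji: "j = J + i" using that by (simp add: i_def)
    have "\<sigma> j * \<kappa> \<le> 2 * sqrt 2 / \<rho> ^ i"
      using k(2) r(1) unfolding ji \<sigma>_def by (simp add: field_simps power_add)
    then have "(\<sigma> j * \<kappa>)\<^sup>2 \<le> (2 * sqrt 2 / \<rho> ^ i)\<^sup>2" using r(1) \<kappa>0 by (intro power_mono) (auto simp: \<sigma>_def)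
    then have "v j \<le> 4 / (\<rho> ^ i)\<^sup>2" by (simp add: v_def power_mult_distrib power_divide)
    also have "\<dots> \<le> 4 / 2 ^ i" using rk[of i] r(1) by (intro divide_left_mono) auto
    finally show ?thesis by (simp add: i_def power_divide)
  qed
  have "(\<Sum>\<sigma>\<leftarrow>map \<sigma> [Suc J..<Suc N]. (\<sigma> * \<kappa>)\<^sup>2 / 2) = (\<Sum>j\<in>{Suc J..<Suc N}. v j)"
    unfolding atLeastLessThan_upt
    by (subst sum.distinct_set_conv_list) (simp_all add: v_def o_def del: upt_Suc)
  also have "\<dots> \<le> (\<Sum>j\<in>{Suc J..<Suc N}. 4 * (1 / 2) ^ (j - J))"
    by (intro sum_mono fine)
  also have "\<dots> = (\<Sum>i\<in>{1..<Suc (N - J)}. 4 * (1 / 2) ^ i)"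
    by (rule sum.reindex_bij_witness[of _ "\<lambda>i. i + J" "\<lambda>j. j - J"]) (use J in auto)
  also have "\<dots> = 4 * (1 - (1/2) ^ (N - J))"
    by (rule geo2)
  also have "\<dots> \<le> 4" by simp
  finally have fine': "exp (- 4) \<le> exp (- (\<Sum>\<sigma>\<leftarrow>map \<sigma> [Suc J..<Suc N]. (\<sigma> * \<kappa>)\<^sup>2 / 2))" by simp
  have len: "length (map \<sigma> [1..<Suc J]) = J" by simp
  have "exp (-4) * (1 / 4) \<le> exp (- (\<Sum>\<sigma>\<leftarrow>map \<sigma> [Suc J..<Suc N]. (\<sigma> * \<kappa>)\<^sup>2 / 2)) * (cmod (osc [] (\<beta> / 2 ^ J) \<kappa>))\<^sup>2"
    by (intro mult_mono fine' osc_Nil_lower) (use b in auto)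
  also have "\<dots> \<le> osc_mean (map \<sigma> [Suc J..<Suc N]) (\<beta> / 2 ^ J) \<kappa>"
    by (rule osc_mean_lower_fine)
  finally have f: "exp (-4) * (1 / 4) \<le> osc_mean (map \<sigma> [Suc J..<Suc N]) (\<beta> / 2 ^ J) \<kappa>" .
  \<comment> \<open>The 8 combines 1/2 from the coarse product and 1/4 from
    \<open>osc_Nil_lower\<close>, which applies because J halvings bring \<beta> down to at most 1
    in modulus.\<close>
  have "(exp (-4) / 8 / 2 ^ J :: real) = ((1 / 2) ^ J * (1 / 2)) * (exp (-4) * (1 / 4))"
    by (simp add: power_divide)
  also have "\<dots> \<le> (\<Prod>\<sigma>\<leftarrow>map \<sigma> [1..<Suc J]. (1 - exp (- (\<sigma> * \<kappa>)\<^sup>2 / 2)) / 2) * osc_mean (map \<sigma> [Suc J..<Suc N]) (\<beta> / 2 ^ J) \<kappa>"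
    by (intro mult_mono coarse' f order_trans[OF _ coarse']) auto
  also have "\<dots> \<le> osc_mean (map \<sigma> [1..<Suc J] @ map \<sigma> [Suc J..<Suc N]) \<beta> \<kappa>"
    using osc_mean_lower_coarse[of \<kappa> "map \<sigma> [1..<Suc J]" "map \<sigma> [Suc J..<Suc N]" \<beta>] unfolding len .
  also have "map \<sigma> [1..<Suc J] @ map \<sigma> [Suc J..<Suc N] = map \<sigma> [1..<Suc N]"
    unfolding split map_append ..
  finally show ?thesis unfolding \<sigma>_def .
qed

subsection \<open>The dual estimate\<close>

lemma integrable_gauss:
  assumes "b > 0"
  shows "integrable lborel (\<lambda>x::'a::euclidean_space. exp (- b * (norm x)\<^sup>2))"
proof -
  have "integrable lborel (\<lambda>x::'a. cmod (complex_of_real (exp (- b * (norm x)\<^sup>2)) * cis (0 \<bullet> x)))"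
    by (rule integrable_norm[OF gauss_cis_integral(1)[OF assms]])
  then show ?thesis by simp
qed

text \<open>One half of the Gaussian exponent absorbs the weight, and the other half is kept for
  integrability.\<close>

lemma bessel_weight_gauss_bounded:
  "\<exists>B. \<forall>x::'a::euclidean_space. (1 + (norm x)\<^sup>2) powr s * exp (- (norm x)\<^sup>2) \<le> B * exp (- (1/2) * (norm x)\<^sup>2)"
proof -
  define m where "m = nat \<lceil>s\<rceil>"
  obtain B where B: "\<And>r::real. r \<ge> 0 \<Longrightarrow> (1 + r) ^ (2 * m) * exp (- (1/2) * r\<^sup>2) \<le> B"
    using power_times_gauss_bounded[of "1/2" "2 * m"] by auto
  have "(1 + (norm x)\<^sup>2) powr s * exp (- (norm x)\<^sup>2) \<le> B * exp (- (1/2) * (norm x)\<^sup>2)" for x :: 'a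
  proof -
    define r where "r = norm x"
    have r: "r \<ge> 0" by (simp add: r_def)
    have "(1 + r\<^sup>2) powr s \<le> (1 + r\<^sup>2) powr real m"
      by (rule powr_mono) (auto simp: m_def real_nat_ceiling_ge)
    also have "\<dots> = (1 + r\<^sup>2) ^ m" by (rule powr_realpow) (simp add: add_pos_nonneg)
    also have "\<dots> \<le> ((1 + r)\<^sup>2) ^ m"
      using r by (intro power_mono) (auto simp: power2_eq_square algebra_simps)
    also have "\<dots> = (1 + r) ^ (2 * m)" by (simp add: power_mult)
    finally have "(1 + r\<^sup>2) powr s * exp (- (1/2) * r\<^sup>2) \<le> (1 + r) ^ (2 * m) * exp (- (1/2) * r\<^sup>2)"
      by (rule mult_right_mono) simp
    also have "\<dots> \<le> B" using B r by blast
    finally have "(1 + r\<^sup>2) powr s * exp (- (1/2) * r\<^sup>2) * exp (- (1/2) * r\<^sup>2) \<le> B * exp (- (1/2) * r\<^sup>2)"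
      by (rule mult_right_mono) simp
    then show ?thesis by (simp add: r_def mult.assoc flip: exp_add)
  qed
  then show ?thesis by blast
qed

lemma continuous_on_bessel_weight: "continuous_on UNIV (\<lambda>x::'a::euclidean_space. (1 + (norm x)\<^sup>2) powr s)"
proof -
  have "1 + (norm x)\<^sup>2 \<noteq> 0" for x :: 'a by (smt (verit) zero_le_power2)
  then show ?thesis by (intro continuous_intros) auto
qed

lemma bessel_weight_measurable [measurable]:
  "(\<lambda>x::'a::euclidean_space. (1 + (norm x)\<^sup>2) powr s) \<in> borel_measurable borel"
  by (rule borel_measurable_continuous_onI[OF continuous_on_bessel_weight])

lemma integrable_bessel_weight_gauss:
  assumes f: "f \<in> borel_measurable borel" and b: "\<And>x. \<bar>f x\<bar> \<le> A * exp (- (norm x)\<^sup>2)"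
  shows "integrable lborel (\<lambda>x::'a::euclidean_space. (1 + (norm x)\<^sup>2) powr s * f x)"
proof -
  obtain B where B: "\<And>x::'a. (1 + (norm x)\<^sup>2) powr s * exp (- (norm x)\<^sup>2) \<le> B * exp (- (1/2) * (norm x)\<^sup>2)"
    using bessel_weight_gauss_bounded by blast
  note [measurable] = f
  have "\<bar>f 0\<bar> \<le> A * exp (- (norm (0::'a))\<^sup>2)" by (rule b)
  then have A: "A \<ge> 0" by simp
  show ?thesis
  proof (rule Bochner_Integration.integrable_bound[OF integrable_mult_right[OF integrable_gauss[of "1/2"]]])
    show "AE x in lborel. norm ((1 + (norm x)\<^sup>2) powr s * f x) \<le> norm ((A * B) * exp (- (1/2) * (norm x)\<^sup>2))"
    proof (rule AE_I2)
      fix x :: 'a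
      have "norm ((1 + (norm x)\<^sup>2) powr s * f x) \<le> (1 + (norm x)\<^sup>2) powr s * (A * exp (- (norm x)\<^sup>2))"
        using b[of x] by (simp add: abs_mult mult_left_mono)
      also have "\<dots> \<le> A * (B * exp (- (1/2) * (norm x)\<^sup>2))"
        using mult_left_mono[OF B[of x] A] by (simp add: mult_ac)
      also have "\<dots> \<le> norm ((A * B) * exp (- (1/2) * (norm x)\<^sup>2))" by simp
      finally show "norm ((1 + (norm x)\<^sup>2) powr s * f x) \<le> norm ((A * B) * exp (- (1/2) * (norm x)\<^sup>2))" .
    qed
  qed (use A in auto)
qed

lemma exp_quadratic_continuous:
  fixes g :: "real^'n \<Rightarrow> complex"
  assumes "exp_quadratic k g"
  shows "continuous_on UNIV g"
  using assms by induction (intro continuous_intros; assumption)+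

text \<open>The linear exponent costs at most (norm y)^2 / 2 + (norm x)^2 / 2, which leaves half of
  the decay guaranteed by rate 1.\<close>

lemma exp_quadratic_bound:
  fixes g :: "real^'n \<Rightarrow> complex"
  assumes "exp_quadratic 1 g"
  shows "\<exists>K. \<forall>x. cmod (g x) \<le> K * exp (- (1/2) * (norm x)\<^sup>2)"
  using assms
proof induction
  case (base k c y)
  show ?case
  proof (intro exI allI)
    fix x :: "real^'n"
    have "1 * (norm x)\<^sup>2 \<le> k * (norm x)\<^sup>2" using base by (intro mult_right_mono) auto
    moreover have "y \<bullet> x \<le> (norm y)\<^sup>2 / 2 + (norm x)\<^sup>2 / 2"
    proof -
      have "y \<bullet> x \<le> norm y * norm x" by (rule norm_cauchy_schwarz)
      moreover have "0 \<le> (norm y - norm x)\<^sup>2" by simp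
      ultimately show ?thesis unfolding power2_diff by linarith
    qed
    ultimately have "- k * (norm x)\<^sup>2 + y \<bullet> x \<le> (norm y)\<^sup>2 / 2 + - (1/2) * (norm x)\<^sup>2" by simp
    then have "exp (- k * (norm x)\<^sup>2 + y \<bullet> x) \<le> exp ((norm y)\<^sup>2 / 2) * exp (- (1/2) * (norm x)\<^sup>2)"
      unfolding exp_add[symmetric] by simp
    then show "cmod (c * complex_of_real (exp (- k * (norm x)\<^sup>2 + y \<bullet> x))) \<le> (cmod c * exp ((norm y)\<^sup>2 / 2)) * exp (- (1/2) * (norm x)\<^sup>2)"
      by (simp add: norm_mult mult.assoc mult_left_mono)
  qed
next
  case (add f g)
  then obtain K L where "\<And>x. cmod (f x) \<le> K * exp (- (1/2) * (norm x)\<^sup>2)" "\<And>x. cmod (g x) \<le> L * exp (- (1/2) * (norm x)\<^sup>2)"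
    by blast
  then show ?case
    by (intro exI[of _ "K + L"] allI) (metis norm_triangle_mono distrib_right)
qed

lemma exp_quadratic_integrable:
  fixes g :: "real^'n \<Rightarrow> complex"
  assumes "exp_quadratic 1 g"
  shows "integrable lborel g" "integrable lborel (\<lambda>x. (1 + (norm x)\<^sup>2) powr s * (cmod (g x))\<^sup>2)"
proof -
  have [measurable]: "g \<in> borel_measurable borel"
    by (rule borel_measurable_continuous_onI[OF exp_quadratic_continuous[OF assms]])
  obtain K where K: "\<And>x. cmod (g x) \<le> K * exp (- (1/2) * (norm x)\<^sup>2)"
    using exp_quadratic_bound[OF assms] by blast
  show "integrable lborel g"
  proof (rule Bochner_Integration.integrable_bound)
    show "integrable lborel (\<lambda>x::real^'n. K * exp (- (1/2) * (norm x)\<^sup>2))"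
      by (intro integrable_mult_right integrable_gauss) simp
    show "AE x in lborel. cmod (g x) \<le> norm (K * exp (- (1/2) * (norm x)\<^sup>2))"
      by (rule AE_I2) (use K in \<open>metis abs_ge_self order_trans real_norm_def\<close>)
  qed simp
  have "(cmod (g x))\<^sup>2 \<le> K\<^sup>2 * exp (- (norm x)\<^sup>2)" for x
  proof -
    have "(cmod (g x))\<^sup>2 \<le> (K * exp (- (1/2) * (norm x)\<^sup>2))\<^sup>2" by (intro power_mono K) simp
    also have "\<dots> = K\<^sup>2 * exp (- (norm x)\<^sup>2)" by (simp add: power_mult_distrib flip: exp_double)
    finally show ?thesis .
  qed
  then show "integrable lborel (\<lambda>x. (1 + (norm x)\<^sup>2) powr s * (cmod (g x))\<^sup>2)"
    by (intro integrable_bessel_weight_gauss[where A="K\<^sup>2"]) auto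
qed

section \<open>From the mixed norm to a weighted inequality for \<open>osc\<close>\<close>

text \<open>A superlevel set of a continuous function is open, so it is not null once it contains a
  point. This justifies evaluating the solution on a path, although a single point is a null
  set.\<close>

lemma esssup_continuous_ge:
  fixes f :: "'a::euclidean_space \<Rightarrow> real"
  assumes f: "continuous_on UNIV f"
  shows "ereal (f x) \<le> esssup lborel (\<lambda>x. ereal (f x))"
proof (rule ccontr)
  define E where "E = esssup lborel (\<lambda>x. ereal (f x))"
  assume "\<not> ?thesis"
  then have lt: "E < ereal (f x)" by (simp add: E_def)
  then obtain c where c: "E < ereal c" "c < f x"
    by (metis ereal_dense2 ereal_less_le linorder_not_le ereal_less_eq(3) less_ereal.simps(1))
  define S where "S = {y. c < f y}"
  have "open S" unfolding S_def by (rule open_Collect_less) (auto intro: f continuous_intros)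
  moreover have "x \<in> S" using c by (simp add: S_def)
  moreover have "S \<in> null_sets lborel"
  proof -
    have "AE y in lborel. ereal (f y) \<le> E" unfolding E_def by (rule esssup_AE)
    then have "AE y in lborel. y \<notin> S"
    proof eventually_elim
      case (elim y)
      then have "ereal (f y) < ereal c" using c(1) by (rule le_less_trans)
      then show ?case by (simp add: S_def)
    qed
    moreover have "S \<in> sets lborel" using \<open>open S\<close> by simp
    ultimately show ?thesis using AE_iff_null_sets by blast
  qed
  ultimately show False
    using open_not_negligible[of S] null_sets_completionI by (auto simp: negligible_iff_null_sets)
qed

text \<open>Cauchy-Schwarz on the unit interval, obtained by integrating the square of cmod (v t) -
  c, where c is the modulus of the mean.\<close>

lemma set_integral_sq_le:
  fixes v :: "real \<Rightarrow> complex"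
  assumes [measurable]: "v \<in> borel_measurable borel" and B: "\<And>t. cmod (v t) \<le> B"
  shows "ennreal ((cmod (\<integral>t. indicator {0..<1::real} t *\<^sub>R v t \<partial>lborel))\<^sup>2)
         \<le> (\<integral>\<^sup>+t. ennreal ((cmod (v t))\<^sup>2) * indicator {0..<1} t \<partial>lborel)"
proof -
  let ?I = "\<lambda>t. indicat_real {0..<1} t"
  have "0 \<le> B" using B[of 0] norm_ge_zero[of "v 0"] by linarith
  have i1: "integrable lborel (\<lambda>t. ?I t *\<^sub>R v t)"
  proof (rule Bochner_Integration.integrable_bound[where f="\<lambda>t. B * ?I t"])
    show "AE t in lborel. norm (?I t *\<^sub>R v t) \<le> norm (B * ?I t)"
      using B \<open>0 \<le> B\<close> by (auto simp: indicator_def)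
  qed auto
  have i2: "integrable lborel (\<lambda>t. ?I t * cmod (v t))"
    using integrable_norm[OF i1] by simp
  have i3: "integrable lborel (\<lambda>t. ?I t * (cmod (v t))\<^sup>2)"
  proof (rule Bochner_Integration.integrable_bound[where f="\<lambda>t. B\<^sup>2 * ?I t"])
    show "AE t in lborel. norm (?I t * (cmod (v t))\<^sup>2) \<le> norm (B\<^sup>2 * ?I t)"
      using power_mono[OF B, of _ 2] by (auto simp: indicator_def)
  qed auto
  define c where "c = cmod (\<integral>t. ?I t *\<^sub>R v t \<partial>lborel)"
  have c1: "c \<le> (\<integral>t. ?I t * cmod (v t) \<partial>lborel)"
    unfolding c_def using integral_norm_bound[of lborel "\<lambda>t. ?I t *\<^sub>R v t"] by simp
  have "0 \<le> (\<integral>t. ?I t * (cmod (v t) - c)\<^sup>2 \<partial>lborel)"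
    by (intro Bochner_Integration.integral_nonneg) auto
  also have "\<dots> = (\<integral>t. ?I t * (cmod (v t))\<^sup>2 + c\<^sup>2 * ?I t - 2 * c * (?I t * cmod (v t)) \<partial>lborel)"
    by (intro Bochner_Integration.integral_cong refl) (simp add: power2_diff algebra_simps)
  also have "\<dots> = (\<integral>t. ?I t * (cmod (v t))\<^sup>2 \<partial>lborel) + c\<^sup>2 - 2 * c * (\<integral>t. ?I t * cmod (v t) \<partial>lborel)"
    using i2 i3 by simp
  also have "\<dots> \<le> (\<integral>t. ?I t * (cmod (v t))\<^sup>2 \<partial>lborel) + c\<^sup>2 - 2 * c * c"
    using c1 by (intro diff_left_mono mult_left_mono) (auto simp: c_def)
  finally have "c\<^sup>2 \<le> (\<integral>t. ?I t * (cmod (v t))\<^sup>2 \<partial>lborel)"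
    by (simp add: power2_eq_square)
  then have "ennreal (c\<^sup>2) \<le> ennreal (\<integral>t. ?I t * (cmod (v t))\<^sup>2 \<partial>lborel)" by (rule ennreal_leI)
  also have "\<dots> = (\<integral>\<^sup>+t. ennreal (?I t * (cmod (v t))\<^sup>2) \<partial>lborel)"
    by (rule nn_integral_eq_integral[symmetric]) (use i3 in auto)
  also have "\<dots> = (\<integral>\<^sup>+t. ennreal ((cmod (v t))\<^sup>2) * indicator {0..<1} t \<partial>lborel)"
    by (intro nn_integral_cong) (auto simp: indicator_def)
  finally show ?thesis unfolding c_def .
qed

text \<open>At time t the essential supremum dominates the value at \<open>dyadic_path ss t\<close>
  times the i-th axis vector. Averaging that value over the unit time interval and applying Fubini
  tests \<open>fourier f\<close> against \<open>osc\<close>.\<close>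

lemma frac_evol_along_path:
  fixes f :: "real^'n \<Rightarrow> complex" and i :: 'n
  assumes g: "integrable lborel (fourier f)"
  shows "ennreal ((cmod (\<integral>\<xi>. fourier f \<xi> * osc ss (norm \<xi> powr a) (\<xi> $ i) \<partial>lborel) / (2 * pi) ^ CARD('n))\<^sup>2)
         \<le> L2Linf_sq (frac_evol a f)"
proof -
  define g where "g = fourier f"
  define D where "D = (2 * pi) ^ CARD('n)"
  define e where "e = (axis i 1 :: real^'n)"
  define w where "w = (\<lambda>t \<xi>. cis ((dyadic_path ss t *\<^sub>R e) \<bullet> \<xi>) * cis (t * norm \<xi> powr a) * g \<xi>)"
  define v where "v = (\<lambda>t. \<integral>\<xi>. w t \<xi> \<partial>lborel)"
  have D: "D > 0" by (simp add: D_def)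
  have gi: "integrable lborel g" using g by (simp add: g_def)
  have [measurable]: "g \<in> borel_measurable borel" using gi by auto
  have u: "frac_evol a f t x = (1 / complex_of_real D) * (\<integral>\<xi>. cis (x \<bullet> \<xi>) * cis (t * norm \<xi> powr a) * g \<xi> \<partial>lborel)" for t x
    by (simp add: frac_evol_def g_def D_def)
  have cont: "continuous_on UNIV (\<lambda>x. cmod (frac_evol a f t x))" for t
    unfolding u
  proof (intro continuous_on_norm continuous_on_mult continuous_on_const,
         rule continuous_on_integral_dominated[where w="\<lambda>\<xi>. cmod (g \<xi>)"])
    show "(\<lambda>\<xi>. cis (x \<bullet> \<xi>) * cis (t * norm \<xi> powr a) * g \<xi>) \<in> borel_measurable lborel" for x
      unfolding cis_conv_exp by measurable
    show "continuous_on UNIV (\<lambda>x. cis (x \<bullet> \<xi>) * cis (t * norm \<xi> powr a) * g \<xi>)" for \<xi>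
      unfolding cis_conv_exp by (intro continuous_intros)
  qed (use gi in \<open>auto simp: norm_mult\<close>)
  have wm[measurable]: "(\<lambda>(t, \<xi>). w t \<xi>) \<in> borel_measurable (lborel \<Otimes>\<^sub>M lborel)"
    unfolding w_def cis_conv_exp by measurable
  have nw: "cmod (w t \<xi>) = cmod (g \<xi>)" for t \<xi> by (simp add: w_def norm_mult)
  have [measurable]: "v \<in> borel_measurable borel"
    unfolding v_def using lborel.borel_measurable_lebesgue_integral[OF wm] by simp
  have vB: "cmod (v t) \<le> (\<integral>\<xi>. cmod (g \<xi>) \<partial>lborel)" for t
    unfolding v_def using integral_norm_bound[of lborel "w t"] by (simp add: nw)
  have uv: "frac_evol a f t (dyadic_path ss t *\<^sub>R e) = v t / D" for t
    unfolding u v_def w_def by simp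
  have "ennreal ((cmod (\<integral>t. indicator {0..<1::real} t *\<^sub>R (v t / D) \<partial>lborel))\<^sup>2)
         \<le> (\<integral>\<^sup>+t. ennreal ((cmod (v t / D))\<^sup>2) * indicator {0..<1} t \<partial>lborel)"
    by (rule set_integral_sq_le[where B="(\<integral>\<xi>. cmod (g \<xi>) \<partial>lborel) / D"])
       (use vB D in \<open>auto simp: norm_divide divide_right_mono\<close>)
  also have "\<dots> \<le> L2Linf_sq (frac_evol a f)"
    unfolding L2Linf_sq_def
  proof (rule nn_integral_mono)
    fix t :: real
    have "e2ennreal (ereal (cmod (v t / D))) \<le> e2ennreal (esssup lborel (\<lambda>x. ereal (cmod (frac_evol a f t x))))"
      unfolding uv[symmetric] by (intro e2ennreal_mono esssup_continuous_ge cont)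
    then have "ennreal (cmod (v t / D)) ^ 2 \<le> (e2ennreal (esssup lborel (\<lambda>x. ereal (cmod (frac_evol a f t x))))) ^ 2"
      by (intro power_mono) auto
    then show "ennreal ((cmod (v t / D))\<^sup>2) * indicator {0..<1} t \<le> (e2ennreal (esssup lborel (\<lambda>x. ereal (cmod (frac_evol a f t x))))) ^ 2"
      by (simp add: indicator_def ennreal_power)
  qed
  finally have main: "ennreal ((cmod (\<integral>t. indicator {0..<1::real} t *\<^sub>R (v t / D) \<partial>lborel))\<^sup>2) \<le> L2Linf_sq (frac_evol a f)" .
  let ?F = "\<lambda>t \<xi>. indicator {0..<1::real} t *\<^sub>R w t \<xi>"
  have Fm[measurable]: "(\<lambda>(t, \<xi>). ?F t \<xi>) \<in> borel_measurable (lborel \<Otimes>\<^sub>M lborel)" by measurable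
  have wi: "integrable lborel (w t)" for t
  proof (rule Bochner_Integration.integrable_bound[OF gi])
    show "w t \<in> borel_measurable lborel" unfolding w_def cis_conv_exp by measurable
  qed (simp add: nw)
  have "integrable (lborel \<Otimes>\<^sub>M lborel) (\<lambda>(t, \<xi>). ?F t \<xi>)"
  proof (rule lborel_pair.Fubini_integrable[OF Fm])
    have "(\<lambda>t. \<integral>\<xi>. norm (case (t, \<xi>) of (t, \<xi>) \<Rightarrow> ?F t \<xi>) \<partial>lborel) = (\<lambda>t. (\<integral>\<xi>. cmod (g \<xi>) \<partial>lborel) * indicator {0..<1} t)"
      by (auto simp: nw fun_eq_iff indicator_def)
    then show "integrable lborel (\<lambda>t. \<integral>\<xi>. norm (case (t, \<xi>) of (t, \<xi>) \<Rightarrow> ?F t \<xi>) \<partial>lborel)" by simp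
  qed (use wi in auto)
  from lborel_pair.Fubini_integral[OF this]
  have "(\<integral>t. indicator {0..<1::real} t *\<^sub>R v t \<partial>lborel) = (\<integral>\<xi>. (\<integral>t. ?F t \<xi> \<partial>lborel) \<partial>lborel)"
    by (simp add: v_def)
  also have "\<dots> = (\<integral>\<xi>. g \<xi> * osc ss (norm \<xi> powr a) (\<xi> $ i) \<partial>lborel)"
  proof (rule Bochner_Integration.integral_cong[OF refl])
    fix \<xi> :: "real^'n"
    have "?F t \<xi> = g \<xi> * (indicator {0..<1::real} t *\<^sub>R cis (norm \<xi> powr a * t + \<xi> $ i * dyadic_path ss t))" for t
      by (simp add: w_def e_def inner_axis' cis_mult algebra_simps)
    then have "(\<integral>t. ?F t \<xi> \<partial>lborel) = (\<integral>t. g \<xi> * (indicator {0..<1::real} t *\<^sub>R cis (norm \<xi> powr a * t + \<xi> $ i * dyadic_path ss t)) \<partial>lborel)"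
      by (simp only:)
    also have "\<dots> = g \<xi> * osc ss (norm \<xi> powr a) (\<xi> $ i)"
      unfolding osc_def by (rule integral_mult_right_zero)
    finally show "(\<integral>t. ?F t \<xi> \<partial>lborel) = g \<xi> * osc ss (norm \<xi> powr a) (\<xi> $ i)" .
  qed
  finally have I: "(\<integral>t. indicator {0..<1::real} t *\<^sub>R v t \<partial>lborel) = (\<integral>\<xi>. g \<xi> * osc ss (norm \<xi> powr a) (\<xi> $ i) \<partial>lborel)" .
  have "(\<integral>t. indicator {0..<1::real} t *\<^sub>R (v t / D) \<partial>lborel) = (\<integral>t. (indicator {0..<1::real} t *\<^sub>R v t) / D \<partial>lborel)"
    by (intro Bochner_Integration.integral_cong refl) (simp add: scaleR_conv_of_real)
  also have "\<dots> = (\<integral>\<xi>. g \<xi> * osc ss (norm \<xi> powr a) (\<xi> $ i) \<partial>lborel) / D"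
    by (subst integral_divide_zero) (simp only: I)
  finally have "cmod (\<integral>t. indicator {0..<1::real} t *\<^sub>R (v t / D) \<partial>lborel)
      = cmod (\<integral>\<xi>. g \<xi> * osc ss (norm \<xi> powr a) (\<xi> $ i) \<partial>lborel) / D"
    using D by (simp add: norm_divide)
  with main show ?thesis by (simp only: g_def D_def)
qed

lemma cmod_osc_le_1: "cmod (osc ss \<beta> \<kappa>) \<le> 1"
proof -
  have "cmod (osc ss \<beta> \<kappa>) \<le> (\<integral>t. cmod (indicator {0..<1::real} t *\<^sub>R cis (\<beta> * t + \<kappa> * dyadic_path ss t)) \<partial>lborel)"
    unfolding osc_def by (rule integral_norm_bound)
  then show ?thesis by simp
qed

lemma osc_mean_le_1: "osc_mean \<sigma>s \<beta> \<kappa> \<le> 1"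
proof (induction \<sigma>s arbitrary: \<beta>)
  case Nil
  show ?case using power_le_one[OF norm_ge_zero cmod_osc_le_1, of "[]" \<beta> \<kappa> 2] by simp
next
  case (Cons \<sigma> \<sigma>s)
  have "(1 + x) / 2 \<le> 1 \<and> 0 \<le> (1 + x) / 2" if "\<bar>x\<bar> \<le> 1" for x :: real
    using that by auto
  from this[OF abs_cos_exp_le] show ?case
    using Cons[of "\<beta> / 2"] osc_mean_nonneg by (simp only: osc_mean.simps) (intro mult_le_one, auto)
qed

text \<open>The assumed estimate makes g -> integral of g * \<open>osc\<close> a functional bounded
  in the weighted L^2 norm, with a constant that does not depend on the path.\<close>

lemma estimate_along_path:
  fixes g :: "real^'n \<Rightarrow> complex" and i :: 'n
  assumes C: "\<And>f :: real^'n \<Rightarrow> complex. schwartz f \<Longrightarrow>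
           L2Linf_sq (frac_evol a f) \<le> ennreal ((C * sobolev_norm s f)\<^sup>2)"
    and g: "exp_quadratic 1 g"
  shows "(cmod (\<integral>\<xi>. g \<xi> * osc ss (norm \<xi> powr a) (\<xi> $ i) \<partial>lborel))\<^sup>2
         \<le> (C * (2 * pi) ^ CARD('n))\<^sup>2 * (\<integral>\<xi>. (1 + (norm \<xi>)\<^sup>2) powr s * (cmod (g \<xi>))\<^sup>2 \<partial>lborel)"
proof -
  define D where "D = (2 * pi) ^ CARD('n)"
  have D: "D > 0" by (simp add: D_def)
  obtain f where f: "schwartz f" "fourier f = g" using exp_quadratic_is_fourier[OF g] by auto
  define I where "I = (\<integral>\<xi>. (1 + (norm \<xi>)\<^sup>2) powr s * (cmod (g \<xi>))\<^sup>2 \<partial>lborel)"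
  define A where "A = cmod (\<integral>\<xi>. g \<xi> * osc ss (norm \<xi> powr a) (\<xi> $ i) \<partial>lborel)"
  have I: "I \<ge> 0" unfolding I_def by (intro Bochner_Integration.integral_nonneg) auto
  have "ennreal ((A / D)\<^sup>2) \<le> L2Linf_sq (frac_evol a f)"
    using frac_evol_along_path[of f ss a i] exp_quadratic_integrable(1)[OF g] unfolding f(2) A_def D_def by simp
  also have "\<dots> \<le> ennreal ((C * sobolev_norm s f)\<^sup>2)" by (rule C[OF f(1)])
  also have "(C * sobolev_norm s f)\<^sup>2 = C\<^sup>2 * I"
    unfolding sobolev_norm_def f(2) I_def[symmetric] power_mult_distrib using I by simp
  finally have "(A / D)\<^sup>2 \<le> C\<^sup>2 * I" using I by (simp add: ennreal_le_iff)
  then show ?thesis using D unfolding A_def[symmetric] I_def[symmetric] D_def[symmetric]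
    by (simp add: power_divide power_mult_distrib field_simps)
qed

lemma integrable_compact_support:
  fixes F :: "'a::euclidean_space \<Rightarrow> real"
  assumes "continuous_on UNIV F" "\<And>x. norm x \<ge> R \<Longrightarrow> F x = 0"
  shows "integrable lborel F"
proof -
  have "integrable lborel (\<lambda>x. indicator (cball 0 R) x *\<^sub>R F x)"
    by (rule borel_integrable_compact) (auto intro: continuous_on_subset[OF assms(1)])
  moreover have "(\<lambda>x. indicator (cball 0 R) x *\<^sub>R F x) = F"
    using assms(2) by (auto simp: fun_eq_iff indicator_def)
  ultimately show ?thesis by simp
qed

text \<open>
  The estimate along the path is tested with \<open>fourier f\<close> close to \<open>\<rho>\<close> times
  the conjugate of \<open>osc\<close>, which bounds the integral \<open>Q\<close> quadratically by itself.
\<close>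

lemma weighted_osc_bound:
  fixes \<rho> :: "real^'n \<Rightarrow> real" and i :: 'n
  assumes C: "\<And>f :: real^'n \<Rightarrow> complex. schwartz f \<Longrightarrow>
           L2Linf_sq (frac_evol a f) \<le> ennreal ((C * sobolev_norm s f)\<^sup>2)"
    and a: "a > 0"
    and \<rho>: "continuous_on UNIV \<rho>" "\<And>\<xi>. \<rho> \<xi> \<ge> 0" "\<And>\<xi>. (1 + (norm \<xi>)\<^sup>2) powr s * \<rho> \<xi> \<le> 1"
      "\<And>\<xi>. norm \<xi> \<ge> R \<Longrightarrow> \<rho> \<xi> = 0"
  shows "integrable lborel (\<lambda>\<xi>. \<rho> \<xi> * (cmod (osc ss (norm \<xi> powr a) (\<xi> $ i)))\<^sup>2)"
    and "(\<integral>\<xi>. \<rho> \<xi> * (cmod (osc ss (norm \<xi> powr a) (\<xi> $ i)))\<^sup>2 \<partial>lborel) \<le> 16 * (C * (2 * pi) ^ CARD('n))\<^sup>2"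
proof -
  define G where "G = (\<lambda>\<xi>::real^'n. osc ss (norm \<xi> powr a) (\<xi> $ i))"
  define W where "W = (\<lambda>\<xi>::real^'n. (1 + (norm \<xi>)\<^sup>2) powr s)"
  define D where "D = (C * (2 * pi) ^ CARD('n))\<^sup>2"
  define h where "h = (\<lambda>\<xi>. cnj (G \<xi>) * complex_of_real (\<rho> \<xi>))"
  have G: "continuous_on UNIV G"
  proof -
    have "continuous_on UNIV ((\<lambda>(\<beta>, \<kappa>). osc ss \<beta> \<kappa>) \<circ> (\<lambda>\<xi>::real^'n. (norm \<xi> powr a, \<xi> $ i)))"
    proof (rule continuous_on_compose)
      show "continuous_on UNIV (\<lambda>\<xi>::real^'n. (norm \<xi> powr a, \<xi> $ i))"
        using a by (intro continuous_on_Pair continuous_on_powr' continuous_intros) auto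
    qed (rule continuous_on_subset[OF continuous_on_osc], simp)
    then show ?thesis by (simp add: G_def o_def)
  qed
  have G1: "cmod (G \<xi>) \<le> 1" for \<xi> by (simp add: G_def cmod_osc_le_1)
  have h: "continuous_on UNIV h" unfolding h_def by (intro continuous_intros G \<rho>(1))
  have Wc: "continuous_on UNIV W" unfolding W_def by (rule continuous_on_bessel_weight)
  have W0: "W \<xi> \<ge> 0" for \<xi> by (simp add: W_def)
  have [measurable]: "G \<in> borel_measurable borel" "h \<in> borel_measurable borel" "W \<in> borel_measurable borel" "\<rho> \<in> borel_measurable borel"
    using G h Wc \<rho>(1) by (auto intro: borel_measurable_continuous_onI)
  define q where "q = (\<lambda>\<xi>. \<rho> \<xi> * (cmod (G \<xi>))\<^sup>2)"
  have qi: "integrable lborel q"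
    unfolding q_def using \<rho>(4) by (intro integrable_compact_support[where R=R] continuous_intros G \<rho>(1)) auto
  then show "integrable lborel (\<lambda>\<xi>. \<rho> \<xi> * (cmod (osc ss (norm \<xi> powr a) (\<xi> $ i)))\<^sup>2)"
    by (simp add: q_def G_def)
  define Q where "Q = (\<integral>\<xi>. q \<xi> \<partial>lborel)"
  define A where "A = (\<integral>\<xi>. exp (- 1 * (norm (\<xi>::real^'n))\<^sup>2) \<partial>lborel)"
  define B where "B = (\<integral>\<xi>. W \<xi> * (exp (- (norm \<xi>)\<^sup>2))\<^sup>2 \<partial>lborel)"
  have Ai: "integrable lborel (\<lambda>\<xi>::real^'n. exp (- 1 * (norm \<xi>)\<^sup>2))" by (rule integrable_gauss) simp
  have Bi: "integrable lborel (\<lambda>\<xi>::real^'n. W \<xi> * (exp (- (norm \<xi>)\<^sup>2))\<^sup>2)"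
    unfolding W_def
  proof (rule integrable_bessel_weight_gauss[where A=1])
    show "\<bar>(exp (- (norm x)\<^sup>2))\<^sup>2\<bar> \<le> 1 * exp (- (norm x)\<^sup>2)" for x :: "real^'n"
      by (simp add: power2_eq_square mult_left_le)
  qed measurable
  have A0: "A \<ge> 0" unfolding A_def by (intro Bochner_Integration.integral_nonneg) auto
  have B0: "B \<ge> 0" unfolding B_def by (intro Bochner_Integration.integral_nonneg) (auto simp: W0)
  have "Q \<le> 16 * D"
  proof (cases "Q > 0")
    case False
    then show ?thesis by (simp add: D_def) (smt (verit) zero_le_power2)
  next
    case Q: True
    \<comment> \<open>This choice makes both the error \<epsilon> * A in the pairing and the error
      \<epsilon>^2 * B in the weighted norm at most Q / 2; the cap 1 gives \<epsilon>^2 \<le>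
      \<epsilon>.\<close>
    define \<epsilon> where "\<epsilon> = min 1 (Q / (2 * (A + B + 1)))"
    have \<epsilon>: "\<epsilon> > 0" "\<epsilon> \<le> 1" using Q A0 B0 by (auto simp: \<epsilon>_def)
    have "\<epsilon> * (A + B + 1) \<le> Q / (2 * (A + B + 1)) * (A + B + 1)"
      using A0 B0 by (intro mult_right_mono) (auto simp: \<epsilon>_def)
    also have "\<dots> = Q / 2" using A0 B0 by (simp add: field_simps)
    finally have eAB: "\<epsilon> * (A + B + 1) \<le> Q / 2" .
    have "0 \<le> \<epsilon> * A" "0 \<le> \<epsilon> * B" using \<epsilon> A0 B0 by auto
    with eAB have eA: "\<epsilon> * A \<le> Q / 2" and eB1: "\<epsilon> * B \<le> Q / 2" using \<epsilon> by (auto simp: algebra_simps)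
    have "\<epsilon>\<^sup>2 * B \<le> \<epsilon> * B" using \<epsilon> B0 by (intro mult_right_mono) (auto simp: power2_eq_square)
    with eB1 have eB: "\<epsilon>\<^sup>2 * B \<le> Q / 2" by linarith
    obtain g where g: "exp_quadratic 1 g" "\<And>\<xi>. cmod (h \<xi> - g \<xi>) \<le> \<epsilon> * exp (- (norm \<xi>)\<^sup>2)"
      using exp_quadratic_dense[OF h, of R \<epsilon>] \<rho>(4) \<epsilon>(1) by (auto simp: h_def)
    have [measurable]: "g \<in> borel_measurable borel"
      by (rule borel_measurable_continuous_onI[OF exp_quadratic_continuous[OF g(1)]])
    have gG: "integrable lborel (\<lambda>\<xi>. g \<xi> * G \<xi>)"
    proof (rule Bochner_Integration.integrable_bound[OF exp_quadratic_integrable(1)[OF g(1)]])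
      show "AE \<xi> in lborel. cmod (g \<xi> * G \<xi>) \<le> cmod (g \<xi>)"
        by (rule AE_I2) (simp add: norm_mult mult_left_le G1)
    qed measurable
    have hG: "h \<xi> * G \<xi> = complex_of_real (q \<xi>)" for \<xi>
      unfolding h_def q_def of_real_mult complex_norm_square by (simp add: mult_ac)
    have "Q / 2 \<le> cmod (\<integral>\<xi>. g \<xi> * G \<xi> \<partial>lborel)"
    proof -
      have "cmod ((\<integral>\<xi>. complex_of_real (q \<xi>) \<partial>lborel) - (\<integral>\<xi>. g \<xi> * G \<xi> \<partial>lborel))
          = cmod (\<integral>\<xi>. complex_of_real (q \<xi>) - g \<xi> * G \<xi> \<partial>lborel)"
        using qi gG by simp
      also have "\<dots> \<le> (\<integral>\<xi>. \<epsilon> * exp (- 1 * (norm (\<xi>::real^'n))\<^sup>2) \<partial>lborel)"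
      proof (rule order_trans[OF integral_norm_bound integral_mono])
        fix \<xi> :: "real^'n"
        have "cmod (complex_of_real (q \<xi>) - g \<xi> * G \<xi>) = cmod (h \<xi> - g \<xi>) * cmod (G \<xi>)"
          unfolding hG[symmetric] by (simp add: left_diff_distrib[symmetric] norm_mult)
        also have "\<dots> \<le> cmod (h \<xi> - g \<xi>) * 1" by (intro mult_left_mono G1) simp
        also have "\<dots> \<le> \<epsilon> * exp (- 1 * (norm \<xi>)\<^sup>2)" using g(2)[of \<xi>] by simp
        finally show "cmod (complex_of_real (q \<xi>) - g \<xi> * G \<xi>) \<le> \<epsilon> * exp (- 1 * (norm \<xi>)\<^sup>2)" .
      qed (use qi gG Ai in auto)
      also have "\<dots> = \<epsilon> * A" unfolding A_def by simp
      finally have "cmod (complex_of_real Q - (\<integral>\<xi>. g \<xi> * G \<xi> \<partial>lborel)) \<le> Q / 2"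
        using eA by (simp add: Q_def)
      then show ?thesis
        using norm_triangle_ineq2[of "complex_of_real Q" "\<integral>\<xi>. g \<xi> * G \<xi> \<partial>lborel"] Q by simp
    qed
    then have "(Q / 2)\<^sup>2 \<le> (cmod (\<integral>\<xi>. g \<xi> * G \<xi> \<partial>lborel))\<^sup>2"
      using Q by (intro power_mono) auto
    also have "\<dots> \<le> D * (\<integral>\<xi>. W \<xi> * (cmod (g \<xi>))\<^sup>2 \<partial>lborel)"
      using estimate_along_path[OF C g(1), of ss i] unfolding D_def W_def G_def .
    also have "\<dots> \<le> D * (\<integral>\<xi>. 2 * q \<xi> + 2 * \<epsilon>\<^sup>2 * (W \<xi> * (exp (- (norm \<xi>)\<^sup>2))\<^sup>2) \<partial>lborel)"
    proof (intro mult_left_mono integral_mono)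
      show "integrable lborel (\<lambda>\<xi>. W \<xi> * (cmod (g \<xi>))\<^sup>2)"
        unfolding W_def by (rule exp_quadratic_integrable(2)[OF g(1)])
      show "integrable lborel (\<lambda>\<xi>. 2 * q \<xi> + 2 * \<epsilon>\<^sup>2 * (W \<xi> * (exp (- (norm \<xi>)\<^sup>2))\<^sup>2))"
        using qi Bi by auto
      fix \<xi>
      have "cmod (g \<xi>) \<le> cmod (h \<xi>) + \<epsilon> * exp (- (norm \<xi>)\<^sup>2)"
        using g(2)[of \<xi>] norm_triangle_ineq2[of "g \<xi>" "h \<xi>"] by (simp add: norm_minus_commute)
      then have "(cmod (g \<xi>))\<^sup>2 \<le> (cmod (h \<xi>) + \<epsilon> * exp (- (norm \<xi>)\<^sup>2))\<^sup>2"
        by (intro power_mono) auto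
      also have "\<dots> \<le> 2 * (cmod (h \<xi>))\<^sup>2 + 2 * (\<epsilon> * exp (- (norm \<xi>)\<^sup>2))\<^sup>2"
        using sum_squares_bound[of "cmod (h \<xi>)" "\<epsilon> * exp (- (norm \<xi>)\<^sup>2)"] by (simp add: power2_sum)
      finally have "W \<xi> * (cmod (g \<xi>))\<^sup>2 \<le> W \<xi> * (2 * (cmod (h \<xi>))\<^sup>2 + 2 * (\<epsilon> * exp (- (norm \<xi>)\<^sup>2))\<^sup>2)"
        by (rule mult_left_mono) (rule W0)
      also have "\<dots> = 2 * (W \<xi> * (cmod (h \<xi>))\<^sup>2) + 2 * \<epsilon>\<^sup>2 * (W \<xi> * (exp (- (norm \<xi>)\<^sup>2))\<^sup>2)"
        by (simp only: power_mult_distrib distrib_left mult_ac)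
      \<comment> \<open>The bound 1 on weight times \<rho> lets the weighted norm of
        \<open>h\<close> be controlled by the same density \<open>q\<close> that its pairing with
        \<open>G\<close> produces.\<close>
      also have "W \<xi> * (cmod (h \<xi>))\<^sup>2 \<le> q \<xi>"
      proof -
        have "W \<xi> * (cmod (h \<xi>))\<^sup>2 = (W \<xi> * \<rho> \<xi>) * q \<xi>"
          using \<rho>(2)[of \<xi>] by (simp add: h_def q_def norm_mult power_mult_distrib power2_eq_square)
        also have "\<dots> \<le> 1 * q \<xi>"
          using \<rho>(2,3)[of \<xi>] by (intro mult_right_mono) (auto simp: W_def q_def)
        finally show ?thesis by simp
      qed
      finally show "W \<xi> * (cmod (g \<xi>))\<^sup>2 \<le> 2 * q \<xi> + 2 * \<epsilon>\<^sup>2 * (W \<xi> * (exp (- (norm \<xi>)\<^sup>2))\<^sup>2)" by simp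
    qed (simp add: D_def)
    also have "(\<integral>\<xi>. 2 * q \<xi> + 2 * \<epsilon>\<^sup>2 * (W \<xi> * (exp (- (norm \<xi>)\<^sup>2))\<^sup>2) \<partial>lborel) = 2 * Q + 2 * \<epsilon>\<^sup>2 * B"
      using qi Bi unfolding Q_def B_def by simp
    also have "D * (2 * Q + 2 * \<epsilon>\<^sup>2 * B) \<le> D * (4 * Q)"
      using eB Q by (intro mult_left_mono) (auto simp: D_def)
    \<comment> \<open>The pairing is at least Q / 2, so Q^2 / 4 \<le> 4 D Q; this is the origin of
      the constant 16.\<close>
    finally have "Q * Q \<le> (16 * D) * Q" by (simp add: power2_eq_square algebra_simps)
    then show ?thesis using Q by simp
  qed
  then show "(\<integral>\<xi>. \<rho> \<xi> * (cmod (osc ss (norm \<xi> powr a) (\<xi> $ i)))\<^sup>2 \<partial>lborel) \<le> 16 * (C * (2 * pi) ^ CARD('n))\<^sup>2"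
    by (simp add: Q_def q_def G_def D_def)
qed

subsection \<open>Divergence over the dyadic scales\<close>

text \<open>With q = 2 powr (1 / a), scale J offers a box of volume about q powr (J n), a weight of
  about q powr (- J (n - a)), and a mean of at least about 2 powr (-J) = q powr (- J a). The product
  does not depend on J, and disjointness of the boxes lets the N scales add up.\<close>

lemma osc_mean_integral_lower:
  fixes \<rho> :: "real^'n \<Rightarrow> real" and i :: 'n
  defines "n \<equiv> CARD('n)"
  assumes a: "0 < a" "a \<le> 2" "a \<le> real n"
    and \<rho>: "\<rho> \<in> borel_measurable borel" "\<And>\<xi>. \<rho> \<xi> \<ge> 0"
      "\<And>\<xi>. norm \<xi> \<le> (2 powr (1 / a)) ^ N \<Longrightarrow> \<rho> \<xi> = 1 / (1 + (norm \<xi>)\<^sup>2) powr ((real n - a) / 2)"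
  shows "ennreal (real N * (exp (-4) / 20 / 2 powr ((real n - a) / 2) / (3 * real n) ^ n))
         \<le> (\<integral>\<^sup>+\<xi>. ennreal (\<rho> \<xi>) * ennreal (osc_mean (map (\<lambda>j. 6 / (2 powr (1 / a)) ^ j) [1..<Suc N]) (norm \<xi> powr a) (\<xi> $ i)) \<partial>lborel)"
proof -
  define q where "q = 2 powr (1 / a)"
  define s where "s = (real n - a) / 2"
  define m where "m = (\<lambda>\<xi>. osc_mean (map (\<lambda>j. 6 / q ^ j) [1..<Suc N]) (norm \<xi> powr a) (\<xi> $ i))"
  \<comment> \<open>One third of q ^ J is the lower end of the window for \<kappa> in
    \<open>osc_mean_lower\<close>. It also keeps the box in the ball of radius q ^ J, because norms
    there are at most R J + 7/5 * R J.\<close>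
  define R where "R = (\<lambda>J::nat. q ^ J / 3)"
  \<comment> \<open>The factor \<open>7 / 5 < sqrt 2\<close> keeps the boxes of consecutive scales disjoint also for \<open>a = 2\<close>.\<close>
  define S where "S = (\<lambda>J. cbox (\<chi> j. if j = i then R J else 0) (\<chi> j. if j = i then 7 / 5 * R J else R J / real n) :: (real^'n) set)"
  have n0: "real n > 0" by (simp add: n_def)
  have s0: "s \<ge> 0" using a by (simp add: s_def)
  have q0: "q > 0" by (simp add: q_def)
  \<comment> \<open>Here a \<le> 2 enters: the squared step sizes shrink at least by the factor 2
    per level, as both geometric sums in \<open>osc_mean_lower\<close> require.\<close>
  have "2 powr 1 \<le> 2 powr (1 / a * 2)" using a by (intro powr_mono) (auto simp: field_simps)
  also have "\<dots> = q\<^sup>2" using powr_power[of 2 "1 / a" 2] by (simp add: q_def)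
  finally have q2: "2 \<le> q\<^sup>2" by simp
  have q75: "7 / 5 < q"
  proof (rule ccontr)
    assume "\<not> 7 / 5 < q"
    then have "q\<^sup>2 \<le> (7 / 5)\<^sup>2" using q0 by (intro power_mono) auto
    with q2 show False by (simp add: power2_eq_square)
  qed
  have q1: "q \<ge> 1" using q75 by simp
  have qJa: "(q ^ J) powr a = 2 ^ J" for J
  proof -
    have "q ^ J = 2 powr (real J / a)" using powr_power[of 2 "1 / a" J] by (simp add: q_def)
    then show ?thesis using a by (simp add: powr_powr powr_realpow)
  qed
  have R0: "R J > 0" for J using q0 by (simp add: R_def)
  have inS: "R J \<le> \<xi> $ i" "\<xi> $ i \<le> 7 / 5 * R J" "norm \<xi> \<le> q ^ J" if "\<xi> \<in> S J" for \<xi> J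
  proof -
    from that have b: "(if j = i then R J else 0) \<le> \<xi> $ j" "\<xi> $ j \<le> (if j = i then 7 / 5 * R J else R J / real n)" for j
      by (auto simp: S_def mem_box_cart)
    show "R J \<le> \<xi> $ i" "\<xi> $ i \<le> 7 / 5 * R J" using b[of i] by auto
    have "norm \<xi> \<le> (\<Sum>j\<in>UNIV. \<bar>\<xi> $ j\<bar>)" by (rule norm_le_l1_cart)
    also have "\<dots> \<le> (\<Sum>j\<in>UNIV. R J / real n + (if j = i then 7 / 5 * R J else 0))"
    proof (rule sum_mono)
      fix j
      have "0 \<le> R J / real n" using R0[of J] by simp
      show "\<bar>\<xi> $ j\<bar> \<le> R J / real n + (if j = i then 7 / 5 * R J else 0)"
      proof (cases "j = i")
        case True
        then have "\<bar>\<xi> $ j\<bar> \<le> 7 / 5 * R J" using b[of j] R0[of J] by auto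
        with \<open>0 \<le> R J / real n\<close> have "\<bar>\<xi> $ j\<bar> \<le> R J / real n + 7 / 5 * R J" by linarith
        with True show ?thesis by simp
      qed (use b[of j] in auto)
    qed
    also have "\<dots> = R J + 7 / 5 * R J"
      using n0 by (simp add: sum.distrib n_def)
    also have "\<dots> \<le> 3 * R J" using R0[of J] by simp
    finally show "norm \<xi> \<le> q ^ J" by (simp add: R_def)
  qed
  have Svol: "ennreal (2 / 5 * (q ^ J / (3 * real n)) ^ n) \<le> emeasure lborel (S J)" for J
  proof -
    have ne: "S J \<noteq> {}"
      unfolding S_def interval_ne_empty_cart using R0[of J] by auto
    have "2 / 5 * (q ^ J / (3 * real n)) ^ n = 2 / 5 * (\<Prod>j\<in>(UNIV::'n set). R J / real n)"
      by (simp add: R_def n_def)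
    also have "\<dots> = 2 / 5 * (R J / real n) * (\<Prod>j\<in>UNIV - {i}. R J / real n)"
      by (subst prod.remove[of UNIV i]) auto
    also have "\<dots> \<le> (7 / 5 * R J - R J) * (\<Prod>j\<in>UNIV - {i}. R J / real n)"
    proof (rule mult_right_mono)
      have "R J / real n \<le> R J / 1" using R0[of J] n0 by (intro divide_left_mono) (auto simp: n_def Suc_leI)
      then show "2 / 5 * (R J / real n) \<le> 7 / 5 * R J - R J" by simp
    qed (use R0[of J] in \<open>auto intro!: prod_nonneg\<close>)
    also have "\<dots> = (\<Prod>j\<in>UNIV. (if j = i then 7 / 5 * R J else R J / real n) - (if j = i then R J else 0))"
      by (subst prod.remove[of UNIV i]) (auto intro!: prod.cong)
    also have "\<dots> = measure lborel (S J)"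
      using content_cbox_cart[OF ne[unfolded S_def]] unfolding S_def by simp
    finally have "2 / 5 * (q ^ J / (3 * real n)) ^ n \<le> measure lborel (S J)" .
    then have "ennreal (2 / 5 * (q ^ J / (3 * real n)) ^ n) \<le> ennreal (measure lborel (S J))" by (rule ennreal_leI)
    also have "\<dots> = emeasure lborel (S J)"
      unfolding S_def by (rule emeasure_eq_ennreal_measure[symmetric]) (use emeasure_lborel_cbox_finite in \<open>auto simp: less_top\<close>)
    finally show ?thesis .
  qed
  have disj: "disjoint_family_on S {1..N}"
  proof -
    have no: False if "J < K" "\<xi> \<in> S J" "\<xi> \<in> S K" for J K \<xi>
    proof -
      have "7 / 5 * R J < q * R J" using q75 R0[of J] by (intro mult_strict_right_mono) auto
      also have "\<dots> = R (Suc J)" by (simp add: R_def)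
      also have "\<dots> \<le> R K" using power_increasing[of "Suc J" K q] that(1) q1 by (simp add: R_def)
      also have "\<dots> \<le> \<xi> $ i" using inS[OF that(3)] by simp
      also have "\<dots> \<le> 7 / 5 * R J" using inS[OF that(2)] by simp
      finally show False by simp
    qed
    show ?thesis unfolding disjoint_family_on_def
    proof (intro ballI impI)
      fix J K :: nat assume "J \<noteq> K"
      then consider "J < K" | "K < J" by linarith
      then show "S J \<inter> S K = {}" using no by cases blast+
    qed
  qed
  define k where "k = (\<lambda>J::nat. exp (-4) / 8 / (2 powr s * (q ^ J) ^ n))"
  have kpos: "k J \<ge> 0" for J using q0 by (simp add: k_def)
  have low: "k J \<le> \<rho> \<xi> * m \<xi>" if J: "J \<in> {1..N}" and \<xi>: "\<xi> \<in> S J" for J \<xi>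
  proof -
    have qJ: "1 \<le> q ^ J" using q1 by (rule one_le_power)
    have "q ^ J \<le> q ^ N" using J q1 by (intro power_increasing) auto
    then have "\<rho> \<xi> = 1 / (1 + (norm \<xi>)\<^sup>2) powr s"
      using \<rho>(3)[of \<xi>] inS(3)[OF \<xi>] unfolding q_def s_def by linarith
    \<comment> \<open>On the box 1 + |\<xi>|^2 is at most twice the square of q ^ J. The power q ^ J
      powr a equals 2 ^ J and will cancel the 2 ^ J in the bound for the mean.\<close>
    moreover have "(1 + (norm \<xi>)\<^sup>2) powr s \<le> 2 powr s * (q ^ J) ^ n / 2 ^ J"
    proof -
      have "(norm \<xi>)\<^sup>2 \<le> (q ^ J)\<^sup>2" using inS(3)[OF \<xi>] by (intro power_mono) auto
      moreover have "1 \<le> (q ^ J)\<^sup>2" using qJ by (rule one_le_power)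
      ultimately have "(1 + (norm \<xi>)\<^sup>2) powr s \<le> (2 * (q ^ J)\<^sup>2) powr s"
        using s0 by (intro powr_mono2) auto
      also have "\<dots> = 2 powr s * (q ^ J) powr (real n - a)"
        using qJ q0 by (simp add: powr_mult powr_powr s_def flip: powr_realpow)
      also have "\<dots> = 2 powr s * (q ^ J) ^ n / 2 ^ J"
        using q0 by (simp add: powr_diff qJa powr_realpow)
      finally show ?thesis .
    qed
    moreover have "0 < (1 + (norm \<xi>)\<^sup>2) powr s" by (smt (verit) powr_gt_zero zero_le_power2)
    ultimately have "1 / (2 powr s * (q ^ J) ^ n / 2 ^ J) \<le> \<rho> \<xi>"
      by (metis frac_le order_refl zero_le_one)
    moreover have "exp (-4) / 8 / 2 ^ J \<le> m \<xi>"
      unfolding m_def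
    proof (rule osc_mean_lower)
      show "q ^ J / 3 \<le> \<xi> $ i" using inS(1)[OF \<xi>] by (simp add: R_def)
      have "\<xi> $ i \<le> 7 / 5 * (q ^ J / 3)" using inS(2)[OF \<xi>] by (simp add: R_def)
      also have "\<dots> \<le> sqrt 2 * (q ^ J / 3)"
        using q0 by (intro mult_right_mono real_le_rsqrt) (auto simp: power2_eq_square)
      finally show "\<xi> $ i \<le> sqrt 2 * (q ^ J / 3)" .
      have "norm \<xi> powr a \<le> (q ^ J) powr a" using inS(3)[OF \<xi>] a by (intro powr_mono2) auto
      then show "\<bar>norm \<xi> powr a\<bar> \<le> 2 ^ J" by (simp add: qJa)
    qed (use J q0 q2 in auto)
    ultimately have "1 / (2 powr s * (q ^ J) ^ n / 2 ^ J) * (exp (-4) / 8 / 2 ^ J) \<le> \<rho> \<xi> * m \<xi>"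
      using \<rho>(2) q0 by (intro mult_mono) auto
    then show ?thesis by (simp add: k_def)
  qed
  have [measurable]: "\<rho> \<in> borel_measurable borel" "m \<in> borel_measurable borel"
    unfolding m_def by (rule \<rho>) measurable
  have [measurable]: "S J \<in> sets borel" for J by (simp add: S_def)
  define c where "c = exp (-4) / 20 / 2 powr s / (3 * real n) ^ n"
  have c0: "c \<ge> 0" by (simp add: c_def)
  have level: "ennreal c \<le> (\<integral>\<^sup>+\<xi>. ennreal (\<rho> \<xi> * m \<xi>) * indicator (S J) \<xi> \<partial>lborel)" if J: "J \<in> {1..N}" for J
  proof -
    \<comment> \<open>The powers of q cancel, and 1/8 * 2/5 = 1/20.\<close>
    have "c = k J * (2 / 5 * (q ^ J / (3 * real n)) ^ n)"
      using q0 by (simp add: c_def k_def power_divide)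
    then have "ennreal c = ennreal (k J) * ennreal (2 / 5 * (q ^ J / (3 * real n)) ^ n)"
      using kpos[of J] q0 by (simp only: ennreal_mult[symmetric]) (subst ennreal_mult[symmetric], auto)
    also have "\<dots> \<le> ennreal (k J) * emeasure lborel (S J)"
      by (intro mult_left_mono Svol) auto
    also have "\<dots> = (\<integral>\<^sup>+\<xi>. ennreal (k J) * indicator (S J) \<xi> \<partial>lborel)"
      by (simp add: nn_integral_cmult_indicator)
    also have "\<dots> \<le> (\<integral>\<^sup>+\<xi>. ennreal (\<rho> \<xi> * m \<xi>) * indicator (S J) \<xi> \<partial>lborel)"
      by (rule nn_integral_mono) (auto simp: indicator_def intro!: ennreal_leI low[OF J])
    finally show ?thesis .
  qed
  have "ennreal (real N * c) = (\<Sum>J\<in>{1..N}. ennreal c)"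
    using c0 by (simp add: ennreal_mult ennreal_of_nat_eq_real_of_nat)
  also have "\<dots> \<le> (\<Sum>J\<in>{1..N}. \<integral>\<^sup>+\<xi>. ennreal (\<rho> \<xi> * m \<xi>) * indicator (S J) \<xi> \<partial>lborel)"
    by (intro sum_mono level)
  also have "\<dots> = (\<integral>\<^sup>+\<xi>. (\<Sum>J\<in>{1..N}. ennreal (\<rho> \<xi> * m \<xi>) * indicator (S J) \<xi>) \<partial>lborel)"
    by (rule nn_integral_sum[symmetric]) measurable
  also have "\<dots> \<le> (\<integral>\<^sup>+\<xi>. ennreal (\<rho> \<xi>) * ennreal (m \<xi>) \<partial>lborel)"
  proof (rule nn_integral_mono)
    fix \<xi>
    have "(\<Sum>J\<in>{1..N}. ennreal (\<rho> \<xi> * m \<xi>) * indicator (S J) \<xi>)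
        = ennreal (\<rho> \<xi> * m \<xi>) * indicator (\<Union>(S ` {1..N})) \<xi>"
      by (subst indicator_UN_disjoint[OF _ disj]) (auto simp: sum_distrib_left)
    also have "\<dots> \<le> ennreal (\<rho> \<xi> * m \<xi>) * 1" by (intro mult_left_mono) (auto simp: indicator_def)
    also have "\<dots> = ennreal (\<rho> \<xi>) * ennreal (m \<xi>)"
      using \<rho>(2) by (simp add: ennreal_mult m_def osc_mean_nonneg)
    finally show "(\<Sum>J\<in>{1..N}. ennreal (\<rho> \<xi> * m \<xi>) * indicator (S J) \<xi>) \<le> ennreal (\<rho> \<xi>) * ennreal (m \<xi>)" .
  qed
  finally show ?thesis unfolding c_def s_def m_def q_def .
qed

theorem theorem1p1:
  fixes a :: real
  assumes "0 < a" "a \<le> 2"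
    and "CARD('n::finite) > (if a = 1 then 3 else 2)"
  shows "\<not> (\<exists>C::real. \<forall>f :: real^'n \<Rightarrow> complex. schwartz f \<longrightarrow>
           L2Linf_sq (frac_evol a f) \<le> ennreal ((C * sobolev_norm ((real CARD('n) - a) / 2) f)\<^sup>2))"
proof
  assume "\<exists>C::real. \<forall>f :: real^'n \<Rightarrow> complex. schwartz f \<longrightarrow>
           L2Linf_sq (frac_evol a f) \<le> ennreal ((C * sobolev_norm ((real CARD('n) - a) / 2) f)\<^sup>2)"
  then obtain C :: real where C: "\<And>f :: real^'n \<Rightarrow> complex. schwartz f \<Longrightarrow>
           L2Linf_sq (frac_evol a f) \<le> ennreal ((C * sobolev_norm ((real CARD('n) - a) / 2) f)\<^sup>2)" by blast
  define n where "n = CARD('n)"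
  define s where "s = (real n - a) / 2"
  define c where "c = exp (-4) / 20 / 2 powr s / (3 * real n) ^ n"
  define D where "D = 16 * (C * (2 * pi) ^ n)\<^sup>2"
  have n2: "2 < n" using assms(3) by (auto simp: n_def split: if_splits)
  have "c > 0" using n2 by (simp add: c_def)
  \<comment> \<open>The upper bound \<open>D\<close> is the same for every number of scales, while
    the lower bound grows linearly in it.\<close>
  then obtain N :: nat where N: "D < real N * c" using reals_Archimedean3 by blast
  define T where "T = (2 powr (1 / a)) ^ N"
  \<comment> \<open>The inverse Sobolev weight on the ball of radius \<open>T\<close>, which reaches
    up to the N-th scale, cut off linearly over the next unit shell. Duality by density asks for
    continuity and bounded support.\<close>
  define \<rho> where "\<rho> = (\<lambda>\<xi>::real^'n. min 1 (max 0 (T + 1 - norm \<xi>)) / (1 + (norm \<xi>)\<^sup>2) powr s)"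
  have wpos: "(1 + (norm \<xi>)\<^sup>2) powr s > 0" for \<xi> :: "real^'n"
    by (smt (verit) powr_gt_zero zero_le_power2)
  have cont: "continuous_on UNIV \<rho>"
    unfolding \<rho>_def using wpos less_imp_neq[OF wpos]
    by (intro continuous_on_divide continuous_on_bessel_weight continuous_intros) auto
  have \<rho>0: "\<rho> \<xi> \<ge> 0" for \<xi> by (simp add: \<rho>_def)
  have \<rho>1: "(1 + (norm \<xi>)\<^sup>2) powr s * \<rho> \<xi> \<le> 1" for \<xi>
    using wpos[of \<xi>] by (simp add: \<rho>_def)
  have supp: "\<rho> \<xi> = 0" if "norm \<xi> \<ge> T + 1" for \<xi> using that by (simp add: \<rho>_def)
  have \<rho>T: "\<rho> \<xi> = 1 / (1 + (norm \<xi>)\<^sup>2) powr s" if "norm \<xi> \<le> T" for \<xi> using that by (simp add: \<rho>_def)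
  have \<rho>i: "integrable lborel \<rho>" using cont supp by (rule integrable_compact_support)
  have [measurable]: "\<rho> \<in> borel_measurable borel" using cont by (rule borel_measurable_continuous_onI)
  obtain i :: 'n where True by blast
  let ?m = "\<lambda>\<xi>. osc_mean (map (\<lambda>j. 6 / (2 powr (1 / a)) ^ j) [1..<Suc N]) (norm \<xi> powr a) (\<xi> $ i)"
  have fin: "(\<integral>\<^sup>+\<xi>. ennreal (\<rho> \<xi>) * ennreal (?m \<xi>) \<partial>lborel) < \<infinity>"
  proof -
    have "(\<integral>\<^sup>+\<xi>. ennreal (\<rho> \<xi>) * ennreal (?m \<xi>) \<partial>lborel) \<le> (\<integral>\<^sup>+\<xi>. ennreal (\<rho> \<xi>) * 1 \<partial>lborel)"
      by (intro nn_integral_mono mult_left_mono) (use osc_mean_le_1 in auto)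
    also have "\<dots> < \<infinity>"
      using nn_integral_eq_integral[OF \<rho>i] \<rho>0 by simp
    finally show ?thesis .
  qed
  have "\<exists>ss. (\<integral>\<^sup>+\<xi>. ennreal (\<rho> \<xi>) * ennreal (?m \<xi>) \<partial>lborel)
              \<le> (\<integral>\<^sup>+\<xi>. ennreal (\<rho> \<xi>) * ennreal ((cmod (osc ss (norm \<xi> powr a) (\<xi> $ i)))\<^sup>2) \<partial>lborel)"
    by (rule exists_path_ge_mean[OF _ _ _ _ fin]) (auto simp: lborel.sigma_finite_measure_axioms)
  then obtain ss where ss: "(\<integral>\<^sup>+\<xi>. ennreal (\<rho> \<xi>) * ennreal (?m \<xi>) \<partial>lborel)
              \<le> (\<integral>\<^sup>+\<xi>. ennreal (\<rho> \<xi>) * ennreal ((cmod (osc ss (norm \<xi> powr a) (\<xi> $ i)))\<^sup>2) \<partial>lborel)" by blast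
  note bound = weighted_osc_bound[OF C[folded n_def, folded s_def] assms(1) cont \<rho>0 \<rho>1 supp, where ss=ss and i=i]
  have "ennreal (real N * c) \<le> (\<integral>\<^sup>+\<xi>. ennreal (\<rho> \<xi>) * ennreal (?m \<xi>) \<partial>lborel)"
    unfolding c_def s_def n_def
    by (rule osc_mean_integral_lower) (use assms(1,2) n2 \<rho>0 \<rho>T in \<open>auto simp: n_def s_def T_def\<close>)
  also note ss
  also have "(\<integral>\<^sup>+\<xi>. ennreal (\<rho> \<xi>) * ennreal ((cmod (osc ss (norm \<xi> powr a) (\<xi> $ i)))\<^sup>2) \<partial>lborel)
      = (\<integral>\<^sup>+\<xi>. ennreal (\<rho> \<xi> * (cmod (osc ss (norm \<xi> powr a) (\<xi> $ i)))\<^sup>2) \<partial>lborel)"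
    by (simp add: ennreal_mult \<rho>0)
  also have "\<dots> = ennreal (\<integral>\<xi>. \<rho> \<xi> * (cmod (osc ss (norm \<xi> powr a) (\<xi> $ i)))\<^sup>2 \<partial>lborel)"
    by (rule nn_integral_eq_integral[OF bound(1)]) (auto intro!: AE_I2 mult_nonneg_nonneg \<rho>0)
  also have "\<dots> \<le> ennreal D"
    using bound(2) unfolding D_def n_def by (rule ennreal_leI)
  finally have "real N * c \<le> D" by (simp add: D_def ennreal_le_iff)
  with N show False by simp
qed

end
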